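(* Let $i\in\{0,1\}$ and let $P=(\alpha,\beta)\in\mathbb Z^2$ be a fixed primitive vector with $P\neq(\pm1,0)$. Then the family of irreducible integral binary cubic forms in $\mathcal Fv^{(i)}$ satisfying $f(P)=1$ exhibits non-escape of mass, that is, $$\lim_{T\to\infty}\limsup_{X\to\infty}\frac{N_{P,T}^{(i)}(X)}{N_P^{(i)}(X)}=0 .$$
   Context: Forms and action: $V_{\mathbb R}$ is the space of real binary cubic forms $f(X,Y)=aX^3+bX^2Y+cXY^2+dY^3$, with $\mathrm{GL}_2(\mathbb R)$ acting by the twisted action $(g\cdot f)(X,Y)=\det(g)^{-1}f((X,Y)g)$, where $(X,Y)$ is a row vector. $\mathrm{Disc}(f)=b^2c^2-4ac^3-4b^3d-27a^2d^2+18abcd$. $V_{\mathbb R}^{(0)}$ (resp. $V_{\mathbb R}^{(1)}$) is the set of forms with $\mathrm{Disc}(f)>0$ (resp. $<0$); $V_{\mathbb Z}^{(i)}$ is the set of forms in $V_{\mathbb R}^{(i)}$ with integer coefficients $a,b,c,d$; $V_{\mathbb Z}^{(i),\mathrm{irr}}$ is the subset of forms irreducible over $\mathbb Q$. Fundamental domain: put $n(u)=\begin{pmatrix}1&0\\ u&1\end{pmatrix}$, $a(t)=\begin{pmatrix}t^{-1}&0\\0&t\end{pmatrix}$, $K=\mathrm{SO}_2(\mathbb R)$, $t_0=\sqrt[4]{3}/\sqrt2$; a scalar $\lambda>0$ stands for $\lambda I_2$. Gauss's usual fundamental domain for $\mathrm{GL}_2(\mathbb Z)\backslash\mathrm{GL}_2(\mathbb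 R)$ is $\mathcal F=\{n(u)a(t)k\lambda: u\in\nu(t),\ t\ge t_0,\ k\in K,\ \lambda>0\}$, where $\nu(t)\subset[-\frac12,\frac12]$ is a union of at most two intervals with $\nu(t)=[-\frac12,\frac12]$ for $t\ge1$ (explicitly, up to boundary, $\nu(t)=\{u\in[-\frac12,\frac12]:u^2+t^4\ge1\}$). For $T>t_0$, $\mathcal F_T=\{n(u)a(t)k\lambda\in\mathcal F:t>T\}$. Shape parameter: a real form $f=ax^3+bx^2y+cxy^2+dy^3$ of nonzero discriminant corresponds (Delone–Faddeev) to the cubic $\mathbb R$-algebra with basis $1,\omega,\theta$ and $\omega\theta=-ad$, $\omega^2=-ac+b\omega-a\theta$, $\theta^2=-bd+d\omega-c\theta$. If $\mathrm{Disc}(f)<0$ this algebra is $\mathbb R\oplus\mathbb C$; let $z_\omega,z_\theta$ be the images of $\omega,\theta$ in $(\mathbb R\oplus\mathbb C)/\mathbb R(1,1)\simeq\mathbb C$, with the complex embedding chosen so that $\Im(z_\theta/z_\omega)>0$, and $\tau_f=z_\theta/z_\omega$. If $\mathrm{Disc}(f)>0$, let $x^0=x-\mathrm{Tr}(x)/3$, $A_0=\mathrm{Tr}((\omega^0)^2)$, $B_0=\mathrm{Tr}(\omega^0\theta^0)$, $C_0=\mathrm{Tr}((\theta^0)^2)$, and $\tau_f=(B_0+\sqrt{-1}\sqrt{A_0C_0-B_0^2})/A_0$. For each $i\in\{0,1\}$ a base form $v^{(i)}\in V_{\mathbb R}^{(i)}$ with $\tau_{v^{(i)}}=\sqrt{-1}$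 is fixed. Counts: $\mathcal Fv^{(i)}$ and $\mathcal F_Tv^{(i)}$ are multisets: a form $f$ is counted with multiplicity $\#\{g\in\mathcal F:g\cdot v^{(i)}=f\}$ (resp. $g\in\mathcal F_T$). Fix constants $0<c_-<c_+$. Define $N_P^{(i)}(X)=\#\{f\in\mathcal Fv^{(i)}\cap V_{\mathbb Z}^{(i),\mathrm{irr}}:f(P)=1,\ c_-X\le|\mathrm{Disc}(f)|<c_+X\}$ and $N_{P,T}^{(i)}(X)=\#\{f\in\mathcal F_Tv^{(i)}\cap V_{\mathbb Z}^{(i),\mathrm{irr}}:f(P)=1,\ c_-X\le|\mathrm{Disc}(f)|<c_+X\}$. *)

theory Defs
  imports "HOL-Analysis.Analysis" "HOL-Computational_Algebra.Polynomial"
begin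

section \<open>Binary cubic forms\<close>

text \<open>\<open>BCubic a b c d\<close> is the form \<open>a X^3 + b X^2 Y + c X Y^2 + d Y^3\<close>.\<close>

datatype 'a bcubic = BCubic (cf_a: 'a) (cf_b: 'a) (cf_c: 'a) (cf_d: 'a)

definition bc_eval :: "'a::comm_ring_1 bcubic \<Rightarrow> 'a ^ 2 \<Rightarrow> 'a" where
  "bc_eval f p = cf_a f * (p $ 1) ^ 3 + cf_b f * (p $ 1)\<^sup>2 * (p $ 2)
               + cf_c f * (p $ 1) * (p $ 2)\<^sup>2 + cf_d f * (p $ 2) ^ 3"

definition bc_disc :: "'a::comm_ring_1 bcubic \<Rightarrow> 'a" where
  "bc_disc f = (case f of BCubic a b c d \<Rightarrow>
     b\<^sup>2 * c\<^sup>2 - 4 * a * c ^ 3 - 4 * b ^ 3 * d - 27 * a\<^sup>2 * d\<^sup>2 + 18 * a * b * c * d)"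

text \<open>The twisted action \<open>(g \<cdot> f)(X, Y) = det(g)^{-1} f((X, Y) g)\<close>, expanded into coefficients;
  the two lemmas below characterise it.\<close>

definition bc_act :: "real ^ 2 ^ 2 \<Rightarrow> real bcubic \<Rightarrow> real bcubic" where
  "bc_act g f = (case f of BCubic a b c d \<Rightarrow>
     let p = g $ 1 $ 1; q = g $ 1 $ 2; r = g $ 2 $ 1; s = g $ 2 $ 2 in
     BCubic
       ((a * p ^ 3 + b * p\<^sup>2 * q + c * p * q\<^sup>2 + d * q ^ 3) / det g)
       ((3 * a * p\<^sup>2 * r + b * (2 * p * q * r + p\<^sup>2 * s)
         + c * (2 * p * q * s + q\<^sup>2 * r) + 3 * d * q\<^sup>2 * s) / det g)
       ((3 * a * p * r\<^sup>2 + b * (2 * p * r * s + q * r\<^sup>2)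
         + c * (2 * q * r * s + p * s\<^sup>2) + 3 * d * q * s\<^sup>2) / det g)
       ((a * r ^ 3 + b * r\<^sup>2 * s + c * r * s\<^sup>2 + d * s ^ 3) / det g))"

lemma bc_eval_act: "bc_eval (bc_act g f) x = bc_eval f (x v* g) / det g"
proof (cases f)
  case (BCubic a b c d)
  define p q r s where "p = g $ 1 $ 1" and "q = g $ 1 $ 2" and "r = g $ 2 $ 1" and "s = g $ 2 $ 2"
  define y z where "y = x $ 1" and "z = x $ 2"
  have 1: "(x v* g) $ 1 = p * y + r * z" "(x v* g) $ 2 = q * y + s * z"
    by (simp_all add: vector_matrix_mult_def sum_2 p_def q_def r_def s_def y_def z_def)
  have "a * (p * y + r * z) ^ 3 + b * (p * y + r * z)\<^sup>2 * (q * y + s * z)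
      + c * (p * y + r * z) * (q * y + s * z)\<^sup>2 + d * (q * y + s * z) ^ 3
    = (a * p ^ 3 + b * p\<^sup>2 * q + c * p * q\<^sup>2 + d * q ^ 3) * y ^ 3
    + (3 * a * p\<^sup>2 * r + b * (2 * p * q * r + p\<^sup>2 * s)
         + c * (2 * p * q * s + q\<^sup>2 * r) + 3 * d * q\<^sup>2 * s) * y\<^sup>2 * z
    + (3 * a * p * r\<^sup>2 + b * (2 * p * r * s + q * r\<^sup>2)
         + c * (2 * q * r * s + p * s\<^sup>2) + 3 * d * q * s\<^sup>2) * y * z\<^sup>2
    + (a * r ^ 3 + b * r\<^sup>2 * s + c * r * s\<^sup>2 + d * s ^ 3) * z ^ 3"
    by algebra
  moreover have "A / D * y ^ 3 + B / D * y\<^sup>2 * z + C / D * y * z\<^sup>2 + E / D * z ^ 3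
    = (A * y ^ 3 + B * y\<^sup>2 * z + C * y * z\<^sup>2 + E * z ^ 3) / D" for A B C D E :: real
    by (simp add: add_divide_distrib)
  ultimately show ?thesis
    unfolding bc_eval_def 1 unfolding BCubic bc_act_def Let_def bcubic.case bcubic.sel
    by (simp only: flip: p_def q_def r_def s_def y_def z_def)
qed

lemma bc_eval_inject:
  fixes f h :: "real bcubic"
  assumes "\<And>x. bc_eval f x = bc_eval h x"
  shows "f = h"
proof (cases f; cases h)
  fix a b c d a' b' c' d'
  assume f: "f = BCubic a b c d" and h: "h = BCubic a' b' c' d'"
  have *: "a * x ^ 3 + b * x\<^sup>2 * y + c * x * y\<^sup>2 + d * y ^ 3
         = a' * x ^ 3 + b' * x\<^sup>2 * y + c' * x * y\<^sup>2 + d' * y ^ 3" for x y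
    using assms[of "vector [x, y]"] by (simp add: f h bc_eval_def)
  have 1: "a = a'" using *[of 1 0] by simp
  have 2: "d = d'" using *[of 0 1] by simp
  have 3: "b + c = b' + c'" using *[of 1 1] 1 2 by simp
  have 4: "c - b = c' - b'" using *[of 1 "-1"] 1 2 by simp
  have "b = b'" "c = c'" using 3 4 by linarith+
  with 1 2 show "f = h" by (simp add: f h)
qed

text \<open>The form as an element of \<open>R[X][Y]\<close>: the outer polynomial variable is \<open>Y\<close>, the inner one
  is \<open>X\<close>.\<close>

definition bc_poly :: "'a::comm_ring_1 bcubic \<Rightarrow> 'a poly poly" where
  "bc_poly f = [:monom (cf_a f) 3, monom (cf_b f) 2, monom (cf_c f) 1, monom (cf_d f) 0:]"

lemma poly_bc_poly: "poly (poly (bc_poly f) [:y:]) x = bc_eval f (vector [x, y])"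
  by (simp add: bc_poly_def bc_eval_def poly_monom ring_distribs power2_eq_square power3_eq_cube
      mult.assoc mult.left_commute mult.commute)

definition irreducible_over_rat :: "real bcubic \<Rightarrow> bool" where
  "irreducible_over_rat f \<longleftrightarrow>
     (\<exists>h :: rat bcubic. f = map_bcubic of_rat h \<and> irreducible (bc_poly h))"

text \<open>In the index \<open>i\<close> only the values \<open>0\<close> and \<open>1\<close> are meaningful.\<close>

definition V_real :: "nat \<Rightarrow> real bcubic set" where
  "V_real i = {f. if i = 0 then bc_disc f > 0 else bc_disc f < 0}"

definition V_int :: "nat \<Rightarrow> real bcubic set" where
  "V_int i = {f \<in> V_real i. set_bcubic f \<subseteq> \<int>}"

definition V_int_irr :: "nat \<Rightarrow> real bcubic set" where
  "V_int_irr i = {f \<in> V_int i. irreducible_over_rat f}"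


section \<open>The Delone--Faddeev algebra and the shape parameter\<close>

text \<open>The vector \<open>x\<close> stands for \<open>x $ 1 + x $ 2 * \<omega> + x $ 3 * \<theta>\<close>.\<close>

definition df_one :: "real ^ 3" where "df_one = vector [1, 0, 0]"
definition df_omega :: "real ^ 3" where "df_omega = vector [0, 1, 0]"
definition df_theta :: "real ^ 3" where "df_theta = vector [0, 0, 1]"

definition df_mult :: "real bcubic \<Rightarrow> real ^ 3 \<Rightarrow> real ^ 3 \<Rightarrow> real ^ 3" where
  "df_mult f x y = (case f of BCubic a b c d \<Rightarrow>
     let m = x $ 2 * y $ 2; n = x $ 2 * y $ 3 + x $ 3 * y $ 2; l = x $ 3 * y $ 3 in
     vector
       [x $ 1 * y $ 1 - a * c * m - a * d * n - b * d * l,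
        x $ 1 * y $ 2 + x $ 2 * y $ 1 + b * m + d * l,
        x $ 1 * y $ 3 + x $ 3 * y $ 1 - a * m - c * l])"

lemma df_mult_basis:
  assumes "f = BCubic a b c d"
  shows "df_mult f df_one x = x" and "df_mult f x df_one = x"
    and "df_mult f df_omega df_theta = (- (a * d)) *\<^sub>R df_one"
    and "df_mult f df_theta df_omega = (- (a * d)) *\<^sub>R df_one"
    and "df_mult f df_omega df_omega = (- (a * c)) *\<^sub>R df_one + b *\<^sub>R df_omega - a *\<^sub>R df_theta"
    and "df_mult f df_theta df_theta = (- (b * d)) *\<^sub>R df_one + d *\<^sub>R df_omega - c *\<^sub>R df_theta"
  using assms
  by (simp_all add: df_mult_def df_one_def df_omega_def df_theta_def Let_def vec_eq_iff forall_3)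

lemma bilinear_df_mult: "bilinear (df_mult f)"
  by (cases f)
    (auto simp: bilinear_def df_mult_def Let_def vec_eq_iff forall_3 algebra_simps
      intro!: linearI)

definition df_trace :: "real bcubic \<Rightarrow> real ^ 3 \<Rightarrow> real" where
  "df_trace f x = trace (matrix (df_mult f x))"

definition df_traceless :: "real bcubic \<Rightarrow> real ^ 3 \<Rightarrow> real ^ 3" where
  "df_traceless f x = x - (df_trace f x / 3) *\<^sub>R df_one"

definition df_trace_form :: "real bcubic \<Rightarrow> real ^ 3 \<Rightarrow> real ^ 3 \<Rightarrow> real" where
  "df_trace_form f x y = df_trace f (df_mult f (df_traceless f x) (df_traceless f y))"

definition shape_pos :: "real bcubic \<Rightarrow> complex" where
  "shape_pos f =
    (let A = df_trace_form f df_omega df_omega;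
         B = df_trace_form f df_omega df_theta;
         C = df_trace_form f df_theta df_theta
     in (of_real B + \<i> * of_real (sqrt (A * C - B\<^sup>2))) / of_real A)"

text \<open>Isomorphisms of real algebras from the cubic algebra onto \<open>\<real> \<oplus> \<complex>\<close>, whose multiplication
  is componentwise.\<close>

definition df_iso_RC :: "real bcubic \<Rightarrow> (real ^ 3 \<Rightarrow> real \<times> complex) \<Rightarrow> bool" where
  "df_iso_RC f \<phi> \<longleftrightarrow> linear \<phi> \<and> bij \<phi> \<and> \<phi> df_one = (1, 1) \<and>
     (\<forall>x y. \<phi> (df_mult f x y) = (fst (\<phi> x) * fst (\<phi> y), snd (\<phi> x) * snd (\<phi> y)))"

text \<open>The identification of \<open>(\<real> \<oplus> \<complex>) / \<real>(1, 1)\<close> with \<open>\<complex>\<close>: every class has a unique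
  representative of the form \<open>(0, z)\<close>.\<close>

definition RC_quot :: "real \<times> complex \<Rightarrow> complex" where
  "RC_quot x = snd x - of_real (fst x)"

text \<open>There are exactly two isomorphisms when the discriminant is negative, interchanged by complex
  conjugation; the sign condition singles out one of them.\<close>

definition shape_neg :: "real bcubic \<Rightarrow> complex" where
  "shape_neg f = (THE \<tau>. \<exists>\<phi>. df_iso_RC f \<phi> \<and>
     \<tau> = RC_quot (\<phi> df_theta) / RC_quot (\<phi> df_omega) \<and> Im \<tau> > 0)"

definition shape :: "real bcubic \<Rightarrow> complex" where
  "shape f = (if bc_disc f > 0 then shape_pos f else shape_neg f)"


section \<open>Gauss's fundamental domain\<close>

definition n_mat :: "real \<Rightarrow> real ^ 2 ^ 2" where
  "n_mat u = vector [vector [1, 0], vector [u, 1]]"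

definition a_mat :: "real \<Rightarrow> real ^ 2 ^ 2" where
  "a_mat t = vector [vector [inverse t, 0], vector [0, t]]"

definition t_zero :: real where
  "t_zero = root 4 3 / sqrt 2"

definition nu_closed :: "real \<Rightarrow> real set" where
  "nu_closed t = {u. \<bar>u\<bar> \<le> 1 / 2 \<and> u\<^sup>2 + t ^ 4 \<ge> 1}"

text \<open>The sections \<open>\<nu>(t)\<close> are prescribed only up to boundary points; any such choice is
  admitted.\<close>

definition gauss_sections :: "(real \<Rightarrow> real set) \<Rightarrow> bool" where
  "gauss_sections \<nu> \<longleftrightarrow>
     (\<forall>t\<ge>t_zero.
        (\<exists>I J. is_interval I \<and> is_interval J \<and> \<nu> t = I \<union> J) \<and>
        interior (nu_closed t) \<subseteq> \<nu> t \<and> \<nu> t \<subseteq> nu_closed t) \<and>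
     (\<forall>t\<ge>1. \<nu> t = {-1/2..1/2})"

definition fund_dom :: "(real \<Rightarrow> real set) \<Rightarrow> (real ^ 2 ^ 2) set" where
  "fund_dom \<nu> = {n_mat u ** a_mat t ** k ** mat s | u t k s.
     u \<in> \<nu> t \<and> t \<ge> t_zero \<and> rotation_matrix k \<and> s > 0}"

definition fund_dom_cusp :: "(real \<Rightarrow> real set) \<Rightarrow> real \<Rightarrow> (real ^ 2 ^ 2) set" where
  "fund_dom_cusp \<nu> T = {n_mat u ** a_mat t ** k ** mat s | u t k s.
     u \<in> \<nu> t \<and> t \<ge> t_zero \<and> rotation_matrix k \<and> s > 0 \<and> t > T}"


section \<open>Counting\<close>

text \<open>For a set \<open>G\<close> of matrices, the forms in the multiset \<open>G v\<close> subject to the conditions below,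
  each counted with its multiplicity.\<close>

definition count_forms ::
  "(real ^ 2 ^ 2) set \<Rightarrow> nat \<Rightarrow> real bcubic \<Rightarrow> int \<times> int \<Rightarrow> real \<Rightarrow> real \<Rightarrow> real \<Rightarrow> nat" where
  "count_forms G i v P c1 c2 X =
     (\<Sum>f \<in> {f \<in> (\<lambda>g. bc_act g v) ` G \<inter> V_int_irr i.
               bc_eval f (vector [of_int (fst P), of_int (snd P)]) = 1 \<and>
               c1 * X \<le> \<bar>bc_disc f\<bar> \<and> \<bar>bc_disc f\<bar> < c2 * X}.
        card {g \<in> G. bc_act g v = f})"

definition N_all ::
  "(real \<Rightarrow> real set) \<Rightarrow> nat \<Rightarrow> real bcubic \<Rightarrow> int \<times> int \<Rightarrow> real \<Rightarrow> real \<Rightarrow> real \<Rightarrow> nat" where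
  "N_all \<nu> = count_forms (fund_dom \<nu>)"

definition N_cusp ::
  "(real \<Rightarrow> real set) \<Rightarrow> real \<Rightarrow> nat \<Rightarrow> real bcubic \<Rightarrow> int \<times> int \<Rightarrow> real \<Rightarrow> real \<Rightarrow> real \<Rightarrow> nat" where
  "N_cusp \<nu> T = count_forms (fund_dom_cusp \<nu> T)"

end

theory Submission imports Defs begin

text \<open>
  Write \<open>X = L^4\<close>. A form \<open>f = n(u) a(t) k \<lambda> v\<close> in the fundamental domain with \<open>|Disc f| < c L^4\<close>
  has \<open>a = O(L / t^3)\<close>, \<open>b = O(L / t)\<close> and \<open>c = O(L t)\<close>, and \<open>f(P) = 1\<close> determines \<open>d\<close> since \<open>P\<close> is not
  on the first axis. Irreducibility forces \<open>a \<noteq> 0\<close>, so summing over \<open>\<lfloor>t\<rfloor> \<ge> T - 1\<close> leaves \<open>O(L^3 / T)\<close> forms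
  in the cusp; fibres of \<open>g \<mapsto> g v\<close> are bounded by the order of the finite stabiliser of \<open>v\<close>.

  In the other direction, some \<open>f0\<close> in the interior of the fundamental domain vanishes at \<open>P\<close>, because
  \<open>v\<close> has a real zero that a rotation moves to \<open>P\<close>. By the open mapping theorem a whole box around \<open>f0\<close>
  lies in the fundamental domain, and its dilate by \<open>L\<close> contains at least a constant times \<open>L^3\<close>
  integral forms with \<open>f(P) = 1\<close> that are irreducible mod 2.
\<close>

section \<open>The action in coordinates\<close>

definition mat2 :: "real \<Rightarrow> real \<Rightarrow> real \<Rightarrow> real \<Rightarrow> real ^ 2 ^ 2" where
  "mat2 p q r s = vector [vector [p, q], vector [r, s]]"

lemma mat2_nth [simp]:
  "mat2 p q r s $ 1 $ 1 = p" "mat2 p q r s $ 1 $ 2 = q"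
  "mat2 p q r s $ 2 $ 1 = r" "mat2 p q r s $ 2 $ 2 = s"
  by (simp_all add: mat2_def)

lemma mat2_eq_iff: "g = h \<longleftrightarrow> g $ 1 $ 1 = h $ 1 $ 1 \<and> g $ 1 $ 2 = h $ 1 $ 2
    \<and> g $ 2 $ 1 = h $ 2 $ 1 \<and> g $ 2 $ 2 = h $ 2 $ 2" for g h :: "real ^ 2 ^ 2"
  by (auto simp: vec_eq_iff forall_2)

lemma mat2_cases: obtains p q r s where "g = mat2 p q r s"
proof
  show "g = mat2 (g $ 1 $ 1) (g $ 1 $ 2) (g $ 2 $ 1) (g $ 2 $ 2)"
    by (simp add: mat2_eq_iff)
qed

lemma det_mat2 [simp]: "det (mat2 p q r s) = p * s - q * r"
  by (simp add: det_2)

lemma mat2_mult: "mat2 p q r s ** mat2 p' q' r' s' =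
    mat2 (p * p' + q * r') (p * q' + q * s') (r * p' + s * r') (r * q' + s * s')"
  by (simp add: mat2_eq_iff matrix_matrix_mult_def sum_2)

lemma mat_eq_mat2: "mat x = mat2 x 0 0 x"
  by (simp add: mat2_eq_iff mat_def)

lemma transpose_mat2: "transpose (mat2 p q r s) = mat2 p r q s"
  by (simp add: mat2_eq_iff transpose_def)

text \<open>\<open>subst_form f p q r s\<close> is the untwisted substitution \<open>f (p X + r Y, q X + s Y)\<close>; exchanging the
  two variables maps the coefficient \<open>b\<close> to \<open>c\<close>, so that one function serves for both.\<close>

definition subst_a :: "real bcubic \<Rightarrow> real \<Rightarrow> real \<Rightarrow> real" where
  "subst_a f p q = cf_a f * p ^ 3 + cf_b f * p\<^sup>2 * q + cf_c f * p * q\<^sup>2 + cf_d f * q ^ 3"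

definition subst_b :: "real bcubic \<Rightarrow> real \<Rightarrow> real \<Rightarrow> real \<Rightarrow> real \<Rightarrow> real" where
  "subst_b f p q r s = 3 * cf_a f * p\<^sup>2 * r + cf_b f * (2 * p * q * r + p\<^sup>2 * s)
     + cf_c f * (2 * p * q * s + q\<^sup>2 * r) + 3 * cf_d f * q\<^sup>2 * s"

definition subst_form :: "real bcubic \<Rightarrow> real \<Rightarrow> real \<Rightarrow> real \<Rightarrow> real \<Rightarrow> real bcubic" where
  "subst_form f p q r s =
     BCubic (subst_a f p q) (subst_b f p q r s) (subst_b f r s p q) (subst_a f r s)"

definition bc_scale :: "real \<Rightarrow> real bcubic \<Rightarrow> real bcubic" where
  "bc_scale x f = map_bcubic ((*) x) f"

lemma bc_scale_sel [simp]:
  "cf_a (bc_scale x f) = x * cf_a f" "cf_b (bc_scale x f) = x * cf_b f"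
  "cf_c (bc_scale x f) = x * cf_c f" "cf_d (bc_scale x f) = x * cf_d f"
  by (cases f; simp add: bc_scale_def)+

lemma bc_eq_iff: "f = h \<longleftrightarrow> cf_a f = cf_a h \<and> cf_b f = cf_b h \<and> cf_c f = cf_c h \<and> cf_d f = cf_d h"
  by (cases f; cases h; simp)

lemma bc_act_mat2: "bc_act (mat2 p q r s) f = bc_scale (1 / (p * s - q * r)) (subst_form f p q r s)"
  by (cases f) (simp add: bc_act_def subst_form_def subst_a_def subst_b_def bc_scale_def Let_def algebra_simps add_divide_distrib)

lemma bc_eval_subst: "bc_eval f (vector [p, q]) = subst_a f p q"
  by (simp add: bc_eval_def subst_a_def)

lemma bc_disc_sel: "bc_disc f = (cf_b f)\<^sup>2 * (cf_c f)\<^sup>2 - 4 * cf_a f * cf_c f ^ 3 - 4 * cf_b f ^ 3 * cf_d f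
     - 27 * (cf_a f)\<^sup>2 * (cf_d f)\<^sup>2 + 18 * cf_a f * cf_b f * cf_c f * cf_d f"
  by (cases f) (simp add: bc_disc_def)

lemma bc_disc_subst: "bc_disc (subst_form f p q r s) = (p * s - q * r) ^ 6 * bc_disc f"
  unfolding bc_disc_sel subst_form_def bcubic.sel subst_a_def subst_b_def by algebra

lemma bc_disc_scale: "bc_disc (bc_scale x f) = x ^ 4 * bc_disc f"
  unfolding bc_disc_sel bc_scale_sel by algebra

lemma bc_disc_act: "bc_disc (bc_act g f) = (det g)\<^sup>2 * bc_disc f"
proof (cases g rule: mat2_cases)
  case (1 p q r s)
  show ?thesis
  proof (cases "p * s - q * r = 0")
    case True
    then show ?thesis unfolding 1 bc_act_mat2 bc_disc_scale bc_disc_subst det_mat2 by simp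
  next
    case False
    then show ?thesis unfolding 1 bc_act_mat2 bc_disc_scale bc_disc_subst det_mat2
      by (simp add: field_simps)
  qed
qed

lemma bc_act_mult: "bc_act (h ** g) f = bc_act h (bc_act g f)"
  by (rule bc_eval_inject) (simp add: bc_eval_act vector_matrix_mul_assoc det_mul)

lemma bc_act_one: "bc_act (mat 1) f = f"
  by (rule bc_eval_inject) (simp add: bc_eval_act)

text \<open>The cubic substitution contributes \<open>x ^ 3\<close> and the determinant
  \<open>x ^ 2\<close>, so under the twisted action scalars act by plain dilation.\<close>

lemma bc_act_scalar:
  assumes "x \<noteq> 0"
  shows "bc_act (g ** mat x) f = bc_scale x (bc_act g f)"
  using assms
  by (cases g rule: mat2_cases)
     (simp add: mat_eq_mat2 mat2_mult bc_act_mat2 bc_eq_iff subst_form_def subst_a_def subst_b_def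
        divide_simps, simp add: power2_eq_square power3_eq_cube algebra_simps)

text \<open>A cubic form is odd, so its values at the antipodal points \<open>(1, 0)\<close> and
  \<open>(-1, 0)\<close> of the unit circle are opposite and the intermediate value theorem
  applies.\<close>

lemma bc_real_zero: "\<exists>x y. x\<^sup>2 + y\<^sup>2 = (1::real) \<and> subst_a f x y = 0"
proof -
  let ?h = "\<lambda>t. subst_a f (cos t) (sin t)"
  have cont: "continuous_on {0..pi} ?h" unfolding subst_a_def by (intro continuous_intros)
  have h: "?h 0 = cf_a f" "?h pi = - cf_a f" by (simp_all add: subst_a_def)
  have "\<exists>t\<ge>0. t \<le> pi \<and> ?h t = 0"
  proof (cases "cf_a f \<le> 0")
    case True
    then show ?thesis by (intro IVT') (use cont h in auto)
  next
    case False
    then show ?thesis by (intro IVT2') (use cont h in auto)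
  qed
  then show ?thesis using sin_cos_squared_add2 by blast
qed

section \<open>Finiteness of the fibres\<close>

text \<open>Every form of nonzero discriminant has a real linear factor, hence is equivalent to some
  \<open>b X^2 Y + d Y^3\<close>, whose stabiliser can be computed explicitly.\<close>

lemma finite_stabiliser_normal:
  assumes "b \<noteq> 0" "d \<noteq> 0"
  shows "finite {g. bc_act g (BCubic 0 b 0 d) = BCubic 0 b 0 d}"
proof -
  \<comment> \<open>The case split on \<open>q = 0\<close> will show \<open>p\<close>,
    \<open>s\<close> in \<open>A\<close> and \<open>q\<close> in \<open>B\<close>; the entry
    \<open>r\<close> is then recovered from the determinant, which is again \<open>1\<close> or
    \<open>-1\<close>.\<close>
  define A :: "real set" where "A = {1, -1, 1/2, -1/2}"
  define k where "k = - d / b"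
  have k: "k \<noteq> 0" and d: "d = - k * b" using assms by (auto simp: k_def)
  define B where "B = insert 0 {q :: real. q\<^sup>2 = 1 / (4 * k)}"
  define C where "C = insert 0 ((\<lambda>(p, q, s, e). (p * s - e) / q) ` (A \<times> B \<times> A \<times> A))"
  have "{q :: real. q\<^sup>2 = 1 / (4 * k)} \<subseteq> {sqrt (1 / (4 * k)), - sqrt (1 / (4 * k))}"
    using real_sqrt_abs abs_if by (smt (verit) insertCI mem_Collect_eq subsetI)
  then have finB: "finite B" unfolding B_def by (meson finite.simps finite_subset)
  have fin: "finite ((\<lambda>(p, q, r, s). mat2 p q r s) ` (A \<times> B \<times> C \<times> A))"
    using finB by (auto simp: A_def C_def)
  have "g \<in> (\<lambda>(p, q, r, s). mat2 p q r s) ` (A \<times> B \<times> C \<times> A)"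
    if g: "bc_act g (BCubic 0 b 0 d) = BCubic 0 b 0 d" for g
  proof (cases g rule: mat2_cases)
    case (1 p q r s)
    define e where "e = p * s - q * r"
    \<comment> \<open>An element of the stabiliser preserves the nonzero discriminant, so its
      determinant squares to \<open>1\<close>.\<close>
    have "bc_disc (BCubic 0 b 0 d) = e\<^sup>2 * bc_disc (BCubic 0 b 0 d)"
      using bc_disc_act[of g "BCubic 0 b 0 d"] g by (simp add: 1 e_def)
    then have e2: "e\<^sup>2 = 1" using assms by (simp add: bc_disc_def)
    then have e: "e = 1 \<or> e = -1" by (simp add: power2_eq_1_iff)
    have e0: "e \<noteq> 0" using e by auto
    have eqs: "b * p\<^sup>2 * q + d * q ^ 3 = 0" 
      "b * (2 * p * q * r + p\<^sup>2 * s) + 3 * d * q\<^sup>2 * s = b * e"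
      "b * (2 * r * s * p + r\<^sup>2 * q) + 3 * d * s\<^sup>2 * q = 0"
      "b * r\<^sup>2 * s + d * s ^ 3 = d * e"
      using g e0 unfolding 1 bc_act_mat2 bc_eq_iff bc_scale_sel subst_form_def subst_a_def subst_b_def
      by (auto simp: e_def[symmetric] field_simps)
    \<comment> \<open>Dividing by \<open>b\<close> reduces the four equations to the stabiliser of
      \<open>X^2 Y - k Y^3\<close>.\<close>
    have "b * (q * (p\<^sup>2 - k * q\<^sup>2)) = 0" using eqs(1) unfolding d by algebra
    then have E1: "q * (p\<^sup>2 - k * q\<^sup>2) = 0" using assms by simp
    have "b * (2 * p * q * r + p\<^sup>2 * s - 3 * k * q\<^sup>2 * s - e) = 0" using eqs(2) unfolding d by algebra
    then have E2: "2 * p * q * r + p\<^sup>2 * s - 3 * k * q\<^sup>2 * s = e" using assms by simp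
    have "b * (2 * r * s * p + r\<^sup>2 * q - 3 * k * s\<^sup>2 * q) = 0" using eqs(3) unfolding d by algebra
    then have E3: "2 * r * s * p + r\<^sup>2 * q - 3 * k * s\<^sup>2 * q = 0" using assms by simp
    have "b * (r\<^sup>2 * s - k * s ^ 3 + k * e) = 0" using eqs(4) unfolding d by algebra
    then have E4: "r\<^sup>2 * s - k * s ^ 3 + k * e = 0" using assms by simp
    have "p \<in> A \<and> q \<in> B \<and> r \<in> C \<and> s \<in> A"
    proof (cases "q = 0")
      case True
      have ps: "p * s = e" using e_def True by simp
      have "p * (p * s) = e" using E2 True by (simp add: power2_eq_square mult.assoc)
      then have "p * e = e" using ps by simp
      then have p: "p = 1" using e0 by simp
      then have s: "s = e" using ps by simp
      have "r = 0" using E3 p s e0 True by simp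
      then show ?thesis using p s True e by (auto simp: A_def B_def C_def)
    next
      case False
      then have pk: "p\<^sup>2 = k * q\<^sup>2" using E1 by simp
      \<comment> \<open>Replacing \<open>k q^2\<close> by \<open>p^2\<close> turns the left side of
        \<open>E2\<close> into \<open>2 p (q r - p s)\<close>.\<close>
      have "- 2 * p * e = e" using E2 e_def pk by algebra
      then have "(2 * p + 1) * e = 0" by (simp add: distrib_right)
      then have p: "p = - 1 / 2" using e0 by simp
      have q: "q\<^sup>2 = 1 / (4 * k)" using pk k unfolding p by (simp add: field_simps power2_eq_square)
      have qr: "q * r = - s / 2 - e" using e_def p by simp
      \<comment> \<open>Multiplying \<open>E3\<close> by \<open>q\<close> makes \<open>r\<close>
        occur only in the product \<open>q * r\<close>, which is already known.\<close>
      have "(q * r)\<^sup>2 + 2 * s * p * (q * r) - 3 * (k * q\<^sup>2) * s\<^sup>2 = 0" using E3 by algebra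
      then have "2 * s * e + e\<^sup>2 = 0" unfolding qr pk[symmetric] p
        by (simp add: power2_eq_square algebra_simps)
      then have "e * (2 * s + e) = 0" by algebra
      then have s: "s = - e / 2" using e0 by simp
      have sA: "s \<in> A" using s e by (auto simp: A_def)
      have eA: "e \<in> A" using e by (auto simp: A_def)
      have pA: "p \<in> A" using p by (auto simp: A_def)
      have qB: "q \<in> B" using q by (simp add: B_def)
      have "r = (p * s - e) / q" using e_def False by (simp add: field_simps)
      then have "r \<in> C" unfolding C_def using sA eA pA qB by force
      then show ?thesis using sA pA qB by auto
    qed
    then show ?thesis unfolding 1 by force
  qed
  then show ?thesis by (intro finite_subset[OF _ fin]) blast
qed

text \<open>A rotation moves a real zero of \<open>v\<close> to \<open>(1, 0)\<close>, which kills
  \<open>a\<close>. The discriminant then forces \<open>b\<close> to be nonzero, so a shear can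
  complete the square and kill \<open>c\<close>.\<close>

lemma bc_normal_form:
  assumes "bc_disc v \<noteq> 0"
  obtains g b d where "det g \<noteq> 0" "b \<noteq> 0" "d \<noteq> 0" "bc_act g v = BCubic 0 b 0 d"
proof -
  obtain x y where xy: "x\<^sup>2 + y\<^sup>2 = (1::real)" "subst_a v x y = 0" using bc_real_zero by blast
  define g where "g = mat2 x y (- y) x"
  define w where "w = bc_act g v"
  have detg: "det g = 1" using xy by (simp add: g_def power2_eq_square)
  have wa: "cf_a w = 0" using xy by (simp add: w_def g_def bc_act_mat2 subst_form_def)
  have dw: "bc_disc w \<noteq> 0" using assms detg by (simp add: w_def bc_disc_act)
  then have wb: "cf_b w \<noteq> 0" using wa by (auto simp: bc_disc_sel)
  define h where "h = mat2 1 0 (- cf_c w / (2 * cf_b w)) 1"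
  define z where "z = bc_act h w"
  have z: "cf_a z = 0" "cf_b z = cf_b w" "cf_c z = 0"
    using wa wb by (simp_all add: z_def h_def bc_act_mat2 subst_form_def subst_a_def subst_b_def field_simps)
  have "bc_disc z \<noteq> 0" using dw by (simp add: z_def bc_disc_act h_def)
  then have "cf_d z \<noteq> 0" using z by (auto simp: bc_disc_sel)
  moreover have "bc_act (h ** g) v = BCubic 0 (cf_b z) 0 (cf_d z)"
    using z by (simp add: bc_act_mult w_def[symmetric] z_def[symmetric] bc_eq_iff)
  moreover have "det (h ** g) \<noteq> 0" using detg by (simp add: det_mul h_def)
  ultimately show thesis using that wb z by metis
qed

lemma inj_matrix_mult_left:
  fixes g h :: "real ^ 'n ^ 'n"
  assumes "h ** g = mat 1"
  shows "inj ((**) g)"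
  by (rule inj_on_inverseI[of _ "(**) h"]) (simp add: matrix_mul_assoc assms)

lemma inj_matrix_mult_right:
  fixes g h :: "real ^ 'n ^ 'n"
  assumes "g ** h = mat 1"
  shows "inj (\<lambda>x. x ** g)"
  by (rule inj_on_inverseI[of _ "\<lambda>x. x ** h"]) (simp add: matrix_mul_assoc[symmetric] assms)

lemma finite_stabiliser:
  assumes "bc_disc v \<noteq> 0"
  shows "finite {g. bc_act g v = v}"
proof -
  obtain g b d where g: "det g \<noteq> 0" "b \<noteq> 0" "d \<noteq> 0" "bc_act g v = BCubic 0 b 0 d"
    using bc_normal_form[OF assms] .
  let ?w = "BCubic 0 b 0 d"
  obtain h where h: "g ** h = mat 1" "h ** g = mat 1"
    using g by (metis invertible_def invertible_det_nz)
  have w: "bc_act h ?w = v" by (simp flip: g(4) bc_act_mult add: h bc_act_one)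
  have "inj_on (\<lambda>k. g ** k ** h) {k. bc_act k v = v}"
    using inj_matrix_mult_left[OF h(2)] inj_matrix_mult_right[OF h(2)] by (auto simp: inj_on_def)
  moreover have "(\<lambda>k. g ** k ** h) ` {k. bc_act k v = v} \<subseteq> {k. bc_act k ?w = ?w}"
    using w g(4) by (auto simp: bc_act_mult)
  ultimately show ?thesis using finite_stabiliser_normal[OF g(2,3)]
    by (meson finite_subset inj_on_finite)
qed

text \<open>Left multiplication by the inverse of one element of the fibre embeds the fibre in the
  stabiliser of \<open>v\<close>; that element is invertible because \<open>f\<close> has nonzero
  discriminant.\<close>

lemma fibre_bound:
  assumes "bc_disc f \<noteq> 0"
  shows "finite {g. bc_act g v = f}" (is "finite ?F")
    and "card {g. bc_act g v = f} \<le> card {g. bc_act g v = v}" (is "_ \<le> card ?S")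
proof -
  have "finite ?F \<and> card ?F \<le> card ?S"
  proof (cases "?F = {}")
    case False
    then obtain g where g: "bc_act g v = f" by blast
    have nz: "det g \<noteq> 0" "bc_disc v \<noteq> 0" using assms unfolding g[symmetric] bc_disc_act by auto
    obtain h where h: "g ** h = mat 1" "h ** g = mat 1"
      using nz by (metis invertible_def invertible_det_nz)
    have v: "bc_act h f = v" by (simp flip: g bc_act_mult add: h bc_act_one)
    have inj: "inj_on ((**) h) ?F"
      using inj_matrix_mult_left[OF h(1)] inj_on_subset by blast
    have im: "(**) h ` ?F \<subseteq> ?S" using v by (auto simp: bc_act_mult)
    show ?thesis using finite_stabiliser[OF nz(2)] inj im
      by (meson card_inj_on_le inj_on_finite)
  qed simp
  then show "finite ?F" "card ?F \<le> card ?S" by auto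
qed

section \<open>Irreducibility\<close>

lemma irreducible_bc_poly:
  fixes h :: "rat bcubic"
  assumes d: "cf_d h \<noteq> 0" and no_root: "\<And>y. bc_eval h (vector [1, y]) \<noteq> 0"
  shows "irreducible (bc_poly h)"
proof (rule irreducibleI)
  let ?P = "bc_poly h"
  have deg: "degree ?P = 3" and lc: "lead_coeff ?P = [:cf_d h:]"
    using d by (simp_all add: bc_poly_def monom_0)
  show nz: "?P \<noteq> 0" using deg by auto
  show "\<not> ?P dvd 1" using deg by (auto simp: is_unit_poly_iff)
  have unit: "is_unit [:cf_d h:]" using d by (simp add: is_unit_const_poly_iff dvd_field_iff)
  have no_linear: False if "?P = p * q" and deg1: "degree p = 1" for p q
  proof -
    have "lead_coeff p * lead_coeff q = [:cf_d h:]" using that lc by (simp add: lead_coeff_mult)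
    then have "is_unit (lead_coeff p)" using unit by (metis dvd_trans dvd_triv_left)
    then obtain e where e: "lead_coeff p = [:e:]" "e \<noteq> 0"
      by (fastforce simp: is_unit_poly_iff)
    obtain p0 p1 where "p = [:p0, p1:]" "p1 \<noteq> 0" using deg1 by (rule degree1_coeffs)
    then have p0: "p = [:p0, [:e:]:]" using e(1) by simp
    define r where "r = smult (- 1 / e) p0"
    have "poly p r = 0" using e(2) by (simp add: r_def p0)
    then have "poly ?P r = 0" using that by simp
    then have "poly (poly ?P r) 1 = 0" by simp
    moreover have "poly (poly ?P r) 1 = bc_eval h (vector [1, poly r 1])"
      by (simp add: bc_poly_def bc_eval_def poly_monom power2_eq_square power3_eq_cube algebra_simps)
    ultimately show False using no_root by metis
  qed
  have unit0: "is_unit p" if "?P = p * q" and deg0: "degree p = 0" for p q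
  proof -
    obtain c where c: "p = [:c:]" using deg0 by (elim degree_eq_zeroE)
    have "lead_coeff p * lead_coeff q = [:cf_d h:]" using that lc by (simp add: lead_coeff_mult)
    then have "is_unit (lead_coeff p)" using unit by (metis dvd_trans dvd_triv_left)
    then show ?thesis using c by (simp add: is_unit_const_poly_iff)
  qed
  \<comment> \<open>the leading coefficient in \<open>Y\<close> is a unit, so a proper factor of degree 1 yields a root in \<open>\<rat>[X]\<close>,
    which specialises at \<open>X = 1\<close> to a rational root\<close>
  fix p q assume pq: "?P = p * q"
  have qp: "?P = q * p" using pq by (simp add: mult.commute)
  have "degree p + degree q = 3" using deg nz unfolding pq by (simp add: degree_mult_eq)
  then consider "degree p = 0" | "degree p = 1" | "degree q = 1" | "degree q = 0" by linarith
  then show "is_unit p \<or> is_unit q"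
    using no_linear unit0 pq qp by cases blast+
qed

text \<open>The parity conditions say that the form has no zero on the projective line over the
  field with two elements, so a rational zero in lowest terms would have even numerator and
  denominator.\<close>

lemma irreducible_over_rat_odd:
  fixes a b c d :: int
  assumes odd: "odd a" "odd d" "odd (b + c)"
  shows "irreducible_over_rat (BCubic (of_int a) (of_int b) (of_int c) (of_int d))"
proof -
  let ?h = "BCubic (of_int a) (of_int b) (of_int c) (of_int d) :: rat bcubic"
  have "bc_eval ?h (vector [1, y]) \<noteq> 0" for y
  proof
    assume *: "bc_eval ?h (vector [1, y]) = 0"
    obtain m n where y: "y = Fract m n" "n > 0" "coprime m n" by (cases y) auto
    have yn: "y * of_int n = of_int m" using y by (simp add: Fract_of_int_quotient)
    have "of_int (a * n ^ 3 + b * n\<^sup>2 * m + c * n * m\<^sup>2 + d * m ^ 3)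
        = bc_eval ?h (vector [1, y]) * of_int n ^ 3"
      unfolding of_int_add of_int_mult of_int_power yn[symmetric] bc_eval_def
      by (simp add: power2_eq_square power3_eq_cube algebra_simps)
    then have "a * n ^ 3 + b * n\<^sup>2 * m + c * n * m\<^sup>2 + d * m ^ 3 = 0"
      unfolding * by (metis mult_zero_left of_int_eq_0_iff)
    then have "even (a * n ^ 3 + b * n\<^sup>2 * m + c * n * m\<^sup>2 + d * m ^ 3)" by simp
    then have "even n \<and> even m" using odd by auto
    then show False using y(3) by (metis coprime_common_divisor odd_one)
  qed
  moreover have "cf_d ?h \<noteq> 0" using odd by auto
  ultimately have "irreducible (bc_poly ?h)" by (intro irreducible_bc_poly)
  then show ?thesis unfolding irreducible_over_rat_def by (intro exI[of _ ?h]) simp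
qed

text \<open>If \<open>a = 0\<close>, then \<open>Y\<close> splits off, and the nonzero discriminant
  gives the cofactor positive degree in \<open>Y\<close>, so that it is no unit. This removes the
  forms with \<open>a = 0\<close> from the cusp.\<close>

lemma irreducible_cf_a_nonzero:
  assumes "irreducible_over_rat f" "bc_disc f \<noteq> 0"
  shows "cf_a f \<noteq> 0"
proof
  assume a: "cf_a f = 0"
  obtain h where h: "f = map_bcubic of_rat h" "irreducible (bc_poly h)"
    using assms(1) unfolding irreducible_over_rat_def by blast
  have cd: "\<not> (cf_c f = 0 \<and> cf_d f = 0)" using a assms(2) by (auto simp: bc_disc_sel)
  have "cf_a h = 0" using a h(1) by (cases h) simp
  then have "bc_poly h = [:0, 1:] * [:monom (cf_b h) 2, monom (cf_c h) 1, monom (cf_d h) 0:]"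
    by (simp add: bc_poly_def)
  then have "is_unit ([:0, 1:] :: rat poly poly)
      \<or> is_unit [:monom (cf_b h) 2, monom (cf_c h) 1, monom (cf_d h) 0:]"
    using h(2) irreducibleD by blast
  then have "cf_c h = 0 \<and> cf_d h = 0" by (auto simp: is_unit_poly_iff split: if_splits)
  then show False using cd h(1) by (cases h) simp
qed

lemma odd_form_exists:
  fixes \<alpha> \<beta> :: int
  assumes "coprime \<alpha> \<beta>"
  obtains a b c d :: int where "odd a" "odd d" "odd (b + c)"
    "a * \<alpha> ^ 3 + b * \<alpha>\<^sup>2 * \<beta> + c * \<alpha> * \<beta>\<^sup>2 + d * \<beta> ^ 3 = 1"
proof -
  obtain u w where uw: "u * \<alpha> + w * \<beta> = 1" using assms bezout_int[of \<alpha> \<beta>] by auto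
  \<comment> \<open>correct \<open>X^3 + X Y^2 + Y^3\<close>, which is irreducible mod 2, by an even multiple of the cube
    \<open>(u X + w Y)^3\<close>\<close>
  define k where "k = 1 - (\<alpha> ^ 3 + \<alpha> * \<beta>\<^sup>2 + \<beta> ^ 3)"
  have "odd \<alpha> \<or> odd \<beta>" using assms by (metis coprime_common_divisor odd_one)
  then have k: "even k" by (auto simp: k_def)
  have "(1 + k * u ^ 3) * \<alpha> ^ 3 + (3 * k * u\<^sup>2 * w) * \<alpha>\<^sup>2 * \<beta> + (1 + 3 * k * u * w\<^sup>2) * \<alpha> * \<beta>\<^sup>2
      + (1 + k * w ^ 3) * \<beta> ^ 3
    = (1 - k) + k * (u * \<alpha> + w * \<beta>) ^ 3"
    unfolding k_def by algebra
  also have "\<dots> = 1" unfolding uw by simp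
  finally have eq: "(1 + k * u ^ 3) * \<alpha> ^ 3 + (3 * k * u\<^sup>2 * w) * \<alpha>\<^sup>2 * \<beta> + (1 + 3 * k * u * w\<^sup>2) * \<alpha> * \<beta>\<^sup>2
      + (1 + k * w ^ 3) * \<beta> ^ 3 = 1" .
  show thesis by (rule that[OF _ _ _ eq]) (simp_all add: k)
qed

section \<open>Openness of the orbit map\<close>

lemma open_box:
  fixes S :: "(real \<times> real \<times> real \<times> real) set"
  assumes "open S" "(a, b, c, d) \<in> S"
  obtains \<delta> where "\<delta> > 0"
    "\<And>a' b' c' d'. \<bar>a' - a\<bar> < \<delta> \<Longrightarrow> \<bar>b' - b\<bar> < \<delta> \<Longrightarrow> \<bar>c' - c\<bar> < \<delta> \<Longrightarrow> \<bar>d' - d\<bar> < \<delta>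
       \<Longrightarrow> (a', b', c', d') \<in> S"
proof -
  obtain e where e: "e > 0" "ball (a, b, c, d) e \<subseteq> S"
    using assms open_contains_ball by blast
  show thesis
  proof (rule that[of "e / 4"])
    fix a' b' c' d'
    assume *: "\<bar>a' - a\<bar> < e / 4" "\<bar>b' - b\<bar> < e / 4" "\<bar>c' - c\<bar> < e / 4" "\<bar>d' - d\<bar> < e / 4"
    have "norm (a' - a, b' - b, c' - c, d' - d)
        \<le> norm (a' - a) + (norm (b' - b) + (norm (c' - c) + norm (d' - d)))"
      by (intro order.trans[OF norm_Pair_le] add_left_mono order.refl)
    also have "\<dots> < e" using * by simp
    finally have "(a', b', c', d') \<in> ball (a, b, c, d) e"
      by (simp only: mem_ball dist_commute[of "(a, b, c, d)"]) (simp add: dist_norm)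
    then show "(a', b', c', d') \<in> S" using e by blast
  qed (use e in simp)
qed

text \<open>A nonzero discriminant makes the derivative of the substitution map at the identity
  invertible, so the open mapping theorem applies. Leaving out the twist keeps the map
  polynomial.\<close>

lemma subst_form_open:
  assumes "bc_disc f \<noteq> 0" and "open U" and "(1, 0, 0, 1) \<in> U"
  obtains \<delta> where "\<delta> > 0"
    "\<And>h. \<lbrakk>\<bar>cf_a h - cf_a f\<bar> < \<delta>; \<bar>cf_b h - cf_b f\<bar> < \<delta>; \<bar>cf_c h - cf_c f\<bar> < \<delta>; \<bar>cf_d h - cf_d f\<bar> < \<delta>\<rbrakk>
       \<Longrightarrow> \<exists>p q r s. (p, q, r, s) \<in> U \<and> h = subst_form f p q r s"
proof -
  define a b c d where "a = cf_a f" and "b = cf_b f" and "c = cf_c f" and "d = cf_d f"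
  define D where "D = 3 * bc_disc f"
  have D: "D = 54 * a * b * c * d - 12 * a * c ^ 3 - 81 * a\<^sup>2 * d\<^sup>2 - 12 * b ^ 3 * d + 3 * b\<^sup>2 * c\<^sup>2"
    unfolding D_def bc_disc_sel a_def b_def c_def d_def by simp
  have D0: "D \<noteq> 0" using assms(1) by (simp add: D_def)
  define F where "F = (\<lambda>x :: real \<times> real \<times> real \<times> real.
    let p = fst x; q = fst (snd x); r = fst (snd (snd x)); s = snd (snd (snd x)) in
      (subst_a f p q, subst_b f p q r s, subst_b f r s p q, subst_a f r s))"
  define F' where "F' = (\<lambda>x :: real \<times> real \<times> real \<times> real.
    let p = fst x; q = fst (snd x); r = fst (snd (snd x)); s = snd (snd (snd x)) in
      (3 * a * p + b * q, 2 * b * p + 2 * c * q + 3 * a * r + b * s,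
       c * p + 3 * d * q + 2 * b * r + 2 * c * s, c * r + 3 * d * s))"
  \<comment> \<open>the adjugate of the Sylvester matrix of the partial derivatives of \<open>f\<close>, whose determinant
    is \<open>3 Disc f\<close>\<close>
  define R where "R = 1 / D"
  have R: "D * R = 1" using D0 by (simp add: R_def)
  define G where "G = (\<lambda>x :: real \<times> real \<times> real \<times> real.
    let y = fst x; z = fst (snd x); v = fst (snd (snd x)); w = snd (snd (snd x)) in
      (((15 * b * c * d - 4 * c ^ 3 - 27 * a * d\<^sup>2) * R * y + (2 * b * c\<^sup>2 - 6 * b\<^sup>2 * d) * R * z
         + (9 * a * b * d - b\<^sup>2 * c) * R * v + (2 * b ^ 3 - 6 * a * b * c) * R * w),
       ((3 * b * c\<^sup>2 - 12 * b\<^sup>2 * d + 9 * a * c * d) * R * y + (18 * a * b * d - 6 * a * c\<^sup>2) * R * z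
         + (3 * a * b * c - 27 * a\<^sup>2 * d) * R * v + (18 * a\<^sup>2 * c - 6 * a * b\<^sup>2) * R * w),
       ((18 * b * d\<^sup>2 - 6 * c\<^sup>2 * d) * R * y + (3 * b * c * d - 27 * a * d\<^sup>2) * R * z
         + (18 * a * c * d - 6 * b\<^sup>2 * d) * R * v + (9 * a * b * d - 12 * a * c\<^sup>2 + 3 * b\<^sup>2 * c) * R * w),
       ((2 * c ^ 3 - 6 * b * c * d) * R * y + (9 * a * c * d - b * c\<^sup>2) * R * z
         + (2 * b\<^sup>2 * c - 6 * a * c\<^sup>2) * R * v + (15 * a * b * c - 27 * a\<^sup>2 * d - 4 * b ^ 3) * R * w)))"
  have blG: "bounded_linear G" unfolding G_def Let_def
    by (intro bounded_linear_Pair bounded_linear_add bounded_linear_mult_right[THEN bounded_linear_compose]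
        bounded_linear_fst_comp bounded_linear_snd_comp bounded_linear_fst bounded_linear_snd
        bounded_linear_ident)
  have FG: "F' \<circ> G = id"
  proof
    fix x :: "real \<times> real \<times> real \<times> real"
    obtain y z v w where x: "x = (y, z, v, w)" by (cases x) auto
    \<comment> \<open>The relation between \<open>D\<close> and \<open>R\<close> is used only here;
      what remains are polynomial identities with \<open>R\<close> as a free variable.\<close>
    have e: "D * R * t = t" for t using R by simp
    show "(F' \<circ> G) x = id x"
      unfolding x F'_def G_def Let_def comp_def id_def fst_conv snd_conv prod.inject
      by (intro conjI; rule trans[OF _ e]; unfold D; algebra)
  qed
  have der: "(F has_derivative F') (at (1, 0, 0, 1))"
    unfolding F_def F'_def Let_def subst_a_def subst_b_def
    by (rule has_derivative_eq_rhs, (rule derivative_intros has_derivative_fst has_derivative_snd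
       has_derivative_ident)+)
       (auto simp: fun_eq_iff a_def b_def c_def d_def algebra_simps)
  have cont: "continuous_on U F" unfolding F_def Let_def subst_a_def subst_b_def
    by (intro continuous_intros)
  have "F (1, 0, 0, 1) \<in> interior (F ` U)"
    using sussmann_open_mapping[OF assms(2) cont assms(3) der blG FG, of U] assms(2,3)
    by (simp add: interior_open)
  moreover have "F (1, 0, 0, 1) = (cf_a f, cf_b f, cf_c f, cf_d f)"
    by (simp add: F_def Let_def subst_a_def subst_b_def)
  ultimately have "(cf_a f, cf_b f, cf_c f, cf_d f) \<in> interior (F ` U)" by simp
  from open_box[OF open_interior this] obtain \<delta> where \<delta>: "\<delta> > 0"
    "\<And>a' b' c' d'. \<lbrakk>\<bar>a' - cf_a f\<bar> < \<delta>; \<bar>b' - cf_b f\<bar> < \<delta>; \<bar>c' - cf_c f\<bar> < \<delta>; \<bar>d' - cf_d f\<bar> < \<delta>\<rbrakk>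
       \<Longrightarrow> (a', b', c', d') \<in> interior (F ` U)"
    by blast
  show thesis
  proof (rule that[OF \<delta>(1)])
    fix h :: "real bcubic"
    assume "\<bar>cf_a h - cf_a f\<bar> < \<delta>" "\<bar>cf_b h - cf_b f\<bar> < \<delta>" "\<bar>cf_c h - cf_c f\<bar> < \<delta>" "\<bar>cf_d h - cf_d f\<bar> < \<delta>"
    then have "(cf_a h, cf_b h, cf_c h, cf_d h) \<in> F ` U"
      using \<delta>(2) interior_subset by blast
    then show "\<exists>p q r s. (p, q, r, s) \<in> U \<and> h = subst_form f p q r s"
      by (force simp: F_def Let_def subst_form_def bc_eq_iff)
  qed
qed

section \<open>An open part of the fundamental domain\<close>

text \<open>In terms of the rows \<open>r1 = (p, q)\<close>, \<open>r2 = (r, s)\<close> of \<open>g = n(u) a(t) k \<lambda>\<close> one has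
  \<open>u = (r1 \<bullet> r2) / |r1|^2\<close> and \<open>t^2 = det g / |r1|^2\<close>; the conditions below say \<open>|u| < 1/2\<close>
  and \<open>t > 1\<close>.\<close>

definition reduced :: "real \<Rightarrow> real \<Rightarrow> real \<Rightarrow> real \<Rightarrow> bool" where
  "reduced p q r s \<longleftrightarrow> p\<^sup>2 + q\<^sup>2 < p * s - q * r \<and> 2 * \<bar>p * r + q * s\<bar> < p\<^sup>2 + q\<^sup>2"

lemma reduced_pos: "reduced p q r s \<Longrightarrow> 0 < p\<^sup>2 + q\<^sup>2"
  unfolding reduced_def by (smt (verit) abs_ge_zero)

lemma t_zero_bounds: "0 < t_zero" "1 / 2 \<le> t_zero\<^sup>2" "t_zero \<le> 1"
proof -
  have "1 \<le> root 4 (3 :: real)" using real_root_le_mono[of 4 1 3] by simp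
  moreover have "root 4 (3 :: real) \<le> sqrt 2"
  proof -
    have "sqrt 2 ^ 4 = (4 :: real)" by (simp add: power4_eq_xxxx)
    then have "root 4 4 = sqrt (2 :: real)" using real_root_pos_unique[of 4 "sqrt 2" 4] by simp
    then show ?thesis using real_root_le_mono[of 4 3 4] by simp
  qed
  ultimately have "1 / sqrt 2 \<le> t_zero" "t_zero \<le> 1" 
    by (simp_all add: t_zero_def divide_right_mono)
  moreover from this have "(1 / sqrt 2)\<^sup>2 \<le> t_zero\<^sup>2" by (intro power_mono) auto
  ultimately show "0 < t_zero" "1 / 2 \<le> t_zero\<^sup>2" "t_zero \<le> 1"
    by (auto simp: power_divide intro: less_le_trans[of _ "1 / sqrt 2"])
qed

lemma n_mat_mat2: "n_mat u = mat2 1 0 u 1" and a_mat_mat2: "a_mat t = mat2 (inverse t) 0 0 t"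
  by (simp_all add: n_mat_def a_mat_def mat2_def)

text \<open>This is the Iwasawa decomposition, by Gram-Schmidt on the rows: \<open>k\<close> starts
  with the normalised first row, and the scalar is the square root of the determinant. As
  \<open>t > 1\<close>, the section is the whole interval whatever the choice of
  \<open>\<nu>\<close>.\<close>

lemma reduced_in_fund_dom:
  assumes "gauss_sections \<nu>" "reduced p q r s"
  shows "mat2 p q r s \<in> fund_dom \<nu>"
proof -
  define n where "n = sqrt (p\<^sup>2 + q\<^sup>2)"
  define D where "D = p * s - q * r"
  define x where "x = sqrt D"
  define t where "t = x / n"
  define u where "u = (p * r + q * s) / n\<^sup>2"
  define k where "k = mat2 (p / n) (q / n) (- q / n) (p / n)"
  have n2: "n\<^sup>2 = p\<^sup>2 + q\<^sup>2" by (simp add: n_def)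
  have pos: "0 < p\<^sup>2 + q\<^sup>2" and D: "p\<^sup>2 + q\<^sup>2 < D" and u2: "2 * \<bar>p * r + q * s\<bar> < p\<^sup>2 + q\<^sup>2"
    using assms(2) reduced_pos by (auto simp: reduced_def D_def)
  have n0: "n > 0" using pos by (simp add: n_def)
  have x2: "x\<^sup>2 = D" and x0: "x > 0" using pos D by (simp_all add: x_def)
  have "n < x" using D by (simp add: n_def x_def)
  then have t1: "t > 1" using n0 by (simp add: t_def)
  have "\<bar>u\<bar> = \<bar>p * r + q * s\<bar> / n\<^sup>2" by (simp add: u_def abs_divide)
  also have "\<dots> \<le> 1 / 2" using u2 pos by (simp add: n2 field_simps)
  finally have u: "u \<in> \<nu> t" using assms(1) t1 by (auto simp: gauss_sections_def)
  have kk: "p / n * (p / n) + q / n * (q / n) = 1"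
  proof -
    have "p / n * (p / n) + q / n * (q / n) = (p\<^sup>2 + q\<^sup>2) / n\<^sup>2"
      by (simp add: power2_eq_square add_divide_distrib)
    then show ?thesis unfolding n2[symmetric] using n0 by simp
  qed
  have rot: "rotation_matrix k"
    using kk by (auto simp: rotation_matrix_def orthogonal_matrix_def k_def transpose_mat2 mat2_mult
        mat_eq_mat2 algebra_simps)
  \<comment> \<open>The second row is expanded in the orthogonal basis \<open>(p, q)\<close>,
    \<open>(-q, p)\<close>.\<close>
  have r: "p * (p * r + q * s) - q * D = r * n\<^sup>2" "q * (p * r + q * s) + p * D = s * n\<^sup>2"
    unfolding n2 D_def by algebra+
  have e: "x * x = D" using x2 by (simp add: power2_eq_square)
  have "n_mat u ** a_mat t ** k ** mat x =
      mat2 p q ((p * (p * r + q * s) - q * (x * x)) / n\<^sup>2) ((q * (p * r + q * s) + p * (x * x)) / n\<^sup>2)"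
    using x0 n0 unfolding n_mat_mat2 a_mat_mat2 k_def mat_eq_mat2 mat2_mult u_def t_def
    by (simp add: mat2_eq_iff field_simps power2_eq_square)
  also have "\<dots> = mat2 p q r s" unfolding e r using n0 by simp
  finally have "mat2 p q r s = n_mat u ** a_mat t ** k ** mat x" ..
  then show ?thesis using u t1 t_zero_bounds rot x0 unfolding fund_dom_def by force
qed

lemma fund_dom_scalar:
  assumes "g \<in> fund_dom \<nu>" "x > 0"
  shows "g ** mat x \<in> fund_dom \<nu>"
proof -
  obtain u t k s where g: "g = n_mat u ** a_mat t ** k ** mat s" "u \<in> \<nu> t" "t_zero \<le> t"
    "rotation_matrix k" "s > 0"
    using assms(1) unfolding fund_dom_def by blast
  have "g ** mat x = n_mat u ** a_mat t ** k ** mat (s * x)"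
    unfolding g(1) matrix_mul_assoc[symmetric] by (simp add: mat_eq_mat2 mat2_mult)
  then show ?thesis using g assms(2) unfolding fund_dom_def by force
qed

text \<open>Multiplying the matrix by the scalar \<open>D\<close>, its own determinant, cancels the
  twist and stays in the fundamental domain.\<close>

lemma subst_form_in_orbit:
  assumes "gauss_sections \<nu>" "reduced p q r s"
  shows "subst_form v p q r s \<in> (\<lambda>g. bc_act g v) ` fund_dom \<nu>"
proof -
  define D where "D = p * s - q * r"
  have D: "D > 0" using assms(2) reduced_pos[OF assms(2)] unfolding reduced_def D_def by linarith
  have "subst_form v p q r s = bc_act (mat2 p q r s ** mat D) v"
    using D by (simp add: bc_act_scalar bc_act_mat2 bc_eq_iff flip: D_def)
  then show ?thesis using fund_dom_scalar[OF reduced_in_fund_dom[OF assms] D] by blast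
qed

lemma scale_in_orbit:
  assumes "f \<in> (\<lambda>g. bc_act g v) ` fund_dom \<nu>" "x > 0"
  shows "bc_scale x f \<in> (\<lambda>g. bc_act g v) ` fund_dom \<nu>"
  using assms fund_dom_scalar by (force simp flip: bc_act_scalar)

section \<open>Boxes of forms inside the orbit\<close>

lemma subst_form_mult:
  "subst_form (subst_form v p q r s) x y z w
     = subst_form v (x * p + y * r) (x * q + y * s) (z * p + w * r) (z * q + w * s)"
  unfolding bc_eq_iff subst_form_def bcubic.sel subst_a_def subst_b_def by (intro conjI; algebra)

lemma subst_a_subst_form:
  "subst_a (subst_form v p q r s) x y = subst_a v (x * p + y * r) (x * q + y * s)"
  unfolding subst_form_def bcubic.sel subst_a_def subst_b_def by algebra

definition near :: "real \<Rightarrow> real bcubic \<Rightarrow> real bcubic \<Rightarrow> bool" where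
  "near \<delta> f h \<longleftrightarrow> \<bar>cf_a h - cf_a f\<bar> < \<delta> \<and> \<bar>cf_b h - cf_b f\<bar> < \<delta> \<and> \<bar>cf_c h - cf_c f\<bar> < \<delta> \<and> \<bar>cf_d h - cf_d f\<bar> < \<delta>"

text \<open>The box is built around the transform of \<open>v\<close> by one reduced matrix. Being
  reduced is an open condition, so it survives left multiplication by matrices near the identity,
  and these reach every form near \<open>f\<close>.\<close>

lemma orbit_contains_box:
  assumes \<nu>: "gauss_sections \<nu>" and v: "bc_disc v \<noteq> 0" and \<beta>: "\<beta> \<noteq> 0"
  obtains f \<delta> where "bc_disc f \<noteq> 0" "subst_a f \<alpha> \<beta> = 0" "\<delta> > 0"
    "\<And>h. near \<delta> f h \<Longrightarrow> h \<in> (\<lambda>g. bc_act g v) ` fund_dom \<nu>"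
proof -
  obtain x y where xy: "x\<^sup>2 + y\<^sup>2 = (1::real)" "subst_a v x y = 0" using bc_real_zero by blast
  \<comment> \<open>a reduced matrix \<open>g\<close> such that \<open>(\<alpha>, \<beta>) g\<close> is proportional to the real zero \<open>(x, y)\<close> of \<open>v\<close>\<close>
  define p q r s where "p = - \<alpha> / 2 * x - \<beta> * y" and "q = - \<alpha> / 2 * y + \<beta> * x"
    and "r = - 2 * \<beta> * x + \<alpha> * y" and "s = - 2 * \<beta> * y - \<alpha> * x"
  \<comment> \<open>In the orthonormal frame \<open>(x, y)\<close>, \<open>(-y, x)\<close> the rows
    are \<open>(-\<alpha>/2, \<beta>)\<close> and \<open>(-2\<beta>, -\<alpha>)\<close>: they are
    orthogonal and the second is twice as long, so that \<open>u = 0\<close> and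
    \<open>t ^ 2 = 2\<close>.\<close>
  have pq: "p\<^sup>2 + q\<^sup>2 = \<alpha>\<^sup>2 / 4 + \<beta>\<^sup>2"
  proof -
    have "p\<^sup>2 + q\<^sup>2 = (\<alpha>\<^sup>2 / 4 + \<beta>\<^sup>2) * (x\<^sup>2 + y\<^sup>2)"
      unfolding p_def q_def by (simp add: power2_eq_square algebra_simps)
    then show ?thesis using xy by simp
  qed
  have "p * s - q * r = 2 * (\<alpha>\<^sup>2 / 4 + \<beta>\<^sup>2) * (x\<^sup>2 + y\<^sup>2)"
    unfolding p_def q_def r_def s_def by (simp add: power2_eq_square algebra_simps)
  then have det: "p * s - q * r = 2 * (\<alpha>\<^sup>2 / 4 + \<beta>\<^sup>2)" using xy by simp
  have orth: "p * r + q * s = 0"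
    unfolding p_def q_def r_def s_def by (simp add: power2_eq_square algebra_simps)
  have pos: "0 < \<alpha>\<^sup>2 / 4 + \<beta>\<^sup>2" using \<beta> by (simp add: add_nonneg_pos)
  have red: "reduced p q r s" using pos by (simp add: reduced_def pq det orth)
  define f where "f = subst_form v p q r s"
  have f: "bc_disc f \<noteq> 0" using v pos by (simp add: f_def bc_disc_subst det)
  have lin: "\<alpha> * p + \<beta> * r = - (\<alpha>\<^sup>2 / 2 + 2 * \<beta>\<^sup>2) * x" "\<alpha> * q + \<beta> * s = - (\<alpha>\<^sup>2 / 2 + 2 * \<beta>\<^sup>2) * y"
    unfolding p_def q_def r_def s_def by (simp_all add: power2_eq_square algebra_simps)
  have hom: "subst_a v (m * x) (m * y) = m ^ 3 * subst_a v x y" for m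
    unfolding subst_a_def by algebra
  have fP: "subst_a f \<alpha> \<beta> = 0" unfolding f_def subst_a_subst_form lin hom xy(2) by simp
  define U where "U = {a :: real \<times> real \<times> real \<times> real. reduced (fst a * p + fst (snd a) * r) (fst a * q + fst (snd a) * s)
    (fst (snd (snd a)) * p + snd (snd (snd a)) * r) (fst (snd (snd a)) * q + snd (snd (snd a)) * s)}"
  have "open U" unfolding U_def reduced_def
    by (intro open_Collect_conj open_Collect_less continuous_intros)
  moreover have "(1, 0, 0, 1) \<in> U" using red by (simp add: U_def)
  ultimately obtain \<delta> where \<delta>: "\<delta> > 0" "\<And>h. near \<delta> f h \<Longrightarrow> \<exists>p q r s. (p, q, r, s) \<in> U \<and> h = subst_form f p q r s"
    using subst_form_open[OF f] unfolding near_def by metis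
  show thesis
  proof (rule that[OF f fP \<delta>(1)])
    fix h assume "near \<delta> f h"
    then obtain x y z w where "(x, y, z, w) \<in> U" "h = subst_form f x y z w" using \<delta>(2) by blast
    then show "h \<in> (\<lambda>g. bc_act g v) ` fund_dom \<nu>"
      unfolding f_def subst_form_mult U_def by (auto intro: subst_form_in_orbit[OF \<nu>])
  qed
qed

text \<open>Dilation preserves the orbit and the zero at \<open>(\<alpha>, \<beta>)\<close> and
  scales the discriminant by a fourth power. So its absolute value can be moved to the midpoint of
  \<open>c1\<close> and \<open>c2\<close>, and continuity leaves room for a smaller box.\<close>

lemma orbit_contains_box_disc:
  assumes \<nu>: "gauss_sections \<nu>" and v: "bc_disc v \<noteq> 0" and \<beta>: "\<beta> \<noteq> 0" and c: "0 < c1" "c1 < c2"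
  obtains f \<delta> where "subst_a f \<alpha> \<beta> = 0" "\<delta> > 0"
    "\<And>h. near \<delta> f h \<Longrightarrow> h \<in> (\<lambda>g. bc_act g v) ` fund_dom \<nu> \<and> c1 < \<bar>bc_disc h\<bar> \<and> \<bar>bc_disc h\<bar> < c2"
proof -
  obtain f0 \<delta>0 where f0: "bc_disc f0 \<noteq> 0" "subst_a f0 \<alpha> \<beta> = 0" "\<delta>0 > 0"
    "\<And>h. near \<delta>0 f0 h \<Longrightarrow> h \<in> (\<lambda>g. bc_act g v) ` fund_dom \<nu>"
    using orbit_contains_box[OF \<nu> v \<beta>] by metis
  define m where "m = (c1 + c2) / 2 / \<bar>bc_disc f0\<bar>"
  define x where "x = root 4 m"
  have m: "m > 0" using c f0(1) by (simp add: m_def)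
  then have x: "x > 0" "x ^ 4 = m" by (simp_all add: x_def)
  define f where "f = bc_scale x f0"
  have "\<bar>bc_disc f\<bar> = m * \<bar>bc_disc f0\<bar>" using x m by (simp add: f_def bc_disc_scale abs_mult)
  also have "\<dots> = (c1 + c2) / 2" using f0(1) by (simp add: m_def)
  finally have df: "c1 < \<bar>bc_disc f\<bar>" "\<bar>bc_disc f\<bar> < c2" using c by auto
  define W where "W = {a :: real \<times> real \<times> real \<times> real.
    c1 < \<bar>bc_disc (BCubic (fst a) (fst (snd a)) (fst (snd (snd a))) (snd (snd (snd a))))\<bar> \<and>
    \<bar>bc_disc (BCubic (fst a) (fst (snd a)) (fst (snd (snd a))) (snd (snd (snd a))))\<bar> < c2}"
  have "open W" unfolding W_def bc_disc_sel bcubic.sel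
    by (intro open_Collect_conj open_Collect_less continuous_intros)
  moreover have "(cf_a f, cf_b f, cf_c f, cf_d f) \<in> W" using df by (simp add: W_def)
  ultimately obtain e where e: "e > 0" "\<And>a b c d. \<lbrakk>\<bar>a - cf_a f\<bar> < e; \<bar>b - cf_b f\<bar> < e; \<bar>c - cf_c f\<bar> < e; \<bar>d - cf_d f\<bar> < e\<rbrakk>
       \<Longrightarrow> (a, b, c, d) \<in> W"
    using open_box[of W "cf_a f" "cf_b f" "cf_c f" "cf_d f"] by blast
  show thesis
  proof (rule that[of f "min e (x * \<delta>0)"])
    have "subst_a f \<alpha> \<beta> = x * subst_a f0 \<alpha> \<beta>" by (simp add: f_def subst_a_def algebra_simps)
    then show "subst_a f \<alpha> \<beta> = 0" using f0(2) by simp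
    show "min e (x * \<delta>0) > 0" using e x f0 by simp
    fix h assume h: "near (min e (x * \<delta>0)) f h"
    then have "(cf_a h, cf_b h, cf_c h, cf_d h) \<in> W" by (intro e(2)) (auto simp: near_def)
    then have "c1 < \<bar>bc_disc h\<bar> \<and> \<bar>bc_disc h\<bar> < c2" by (simp add: W_def)
    moreover have "h \<in> (\<lambda>g. bc_act g v) ` fund_dom \<nu>"
    proof -
      have "\<bar>inverse x * z - w\<bar> < \<delta>0" if "\<bar>z - x * w\<bar> < x * \<delta>0" for z w
      proof -
        have "x * \<bar>inverse x * z - w\<bar> = \<bar>x * (inverse x * z - w)\<bar>"
          using x by (simp add: abs_mult)
        also have "x * (inverse x * z - w) = z - x * w" using x by (simp add: algebra_simps)
        finally have "x * \<bar>inverse x * z - w\<bar> = \<bar>z - x * w\<bar>" .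
        then show ?thesis using that x(1) by (metis mult_less_cancel_left_pos)
      qed
      then have "near \<delta>0 f0 (bc_scale (inverse x) h)"
        using h by (simp add: near_def f_def)
      then have "bc_scale x (bc_scale (inverse x) h) \<in> (\<lambda>g. bc_act g v) ` fund_dom \<nu>"
        using f0(4) scale_in_orbit x by blast
      moreover have "bc_scale x (bc_scale (inverse x) h) = h" using x by (simp add: bc_eq_iff)
      ultimately show ?thesis by simp
    qed
    ultimately show "h \<in> (\<lambda>g. bc_act g v) ` fund_dom \<nu> \<and> c1 < \<bar>bc_disc h\<bar> \<and> \<bar>bc_disc h\<bar> < c2" by blast
  qed
qed

section \<open>Counting integers\<close>

lemma card_int_open_interval:
  fixes x w :: real
  shows
  "finite {m :: int. x < of_int m \<and> of_int m < x + w}"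
  "w - 1 \<le> real (card {m :: int. x < of_int m \<and> of_int m < x + w})"
proof -
  have eq: "{m :: int. x < of_int m \<and> of_int m < x + w} = {\<lfloor>x\<rfloor> + 1..\<lceil>x + w\<rceil> - 1}"
    by (auto simp: floor_less_iff less_ceiling_iff add1_zle_eq)
  show "finite {m :: int. x < of_int m \<and> of_int m < x + w}" unfolding eq by simp
  show "w - 1 \<le> real (card {m :: int. x < of_int m \<and> of_int m < x + w})" unfolding eq by simp linarith
qed

text \<open>Leaving out \<open>0\<close> removes the rounding term \<open>1\<close>; the count of
  the coefficient \<open>a\<close> relies on this, as its interval may be short.\<close>

lemma card_int_abs_le:
  fixes A :: real
  assumes "0 \<le> A"
  shows "finite {m :: int. \<bar>of_int m\<bar> \<le> A}"
    and "real (card {m :: int. \<bar>of_int m\<bar> \<le> A}) \<le> 2 * A + 1"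
    and "real (card {m :: int. m \<noteq> 0 \<and> \<bar>of_int m\<bar> \<le> A}) \<le> 2 * A"
proof -
  have eq: "{m :: int. \<bar>of_int m\<bar> \<le> A} = {- \<lfloor>A\<rfloor>..\<lfloor>A\<rfloor>}"
    by (auto simp: abs_le_iff le_floor_iff minus_le_iff)
  have A: "0 \<le> \<lfloor>A\<rfloor>" "of_int \<lfloor>A\<rfloor> \<le> A" using assms by simp_all
  show "finite {m :: int. \<bar>of_int m\<bar> \<le> A}" unfolding eq by simp
  show "real (card {m :: int. \<bar>of_int m\<bar> \<le> A}) \<le> 2 * A + 1" unfolding eq using A by simp
  have "{m :: int. m \<noteq> 0 \<and> \<bar>of_int m\<bar> \<le> A} = {- \<lfloor>A\<rfloor>..\<lfloor>A\<rfloor>} - {0}" using eq by auto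
  then have "card {m :: int. m \<noteq> 0 \<and> \<bar>of_int m\<bar> \<le> A} = nat (2 * \<lfloor>A\<rfloor> + 1) - 1"
    using A by simp
  also have "\<dots> = nat (2 * \<lfloor>A\<rfloor>)" by (simp add: nat_diff_distrib')
  finally show "real (card {m :: int. m \<noteq> 0 \<and> \<bar>of_int m\<bar> \<le> A}) \<le> 2 * A" using A by simp
qed

text \<open>Here \<open>t\<close> is the height of a form in the cusp, and
  \<open>a \<noteq> 0\<close> records irreducibility. The coefficient \<open>d\<close> is absent
  because \<open>f(P) = 1\<close> determines it.\<close>

definition cusp_box :: "real \<Rightarrow> real \<Rightarrow> (int \<times> int \<times> int) set" where
  "cusp_box K T = {(a, b, c). a \<noteq> 0 \<and>
     (\<exists>t\<ge>T. \<bar>of_int a\<bar> \<le> K / t ^ 3 \<and> \<bar>of_int b\<bar> \<le> K / t \<and> \<bar>of_int c\<bar> \<le> K * t)}"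

text \<open>A nonzero integer \<open>a\<close> has absolute value at least \<open>1\<close>, which
  cuts the cusp off at a finite height.\<close>

lemma cusp_box_height:
  assumes "a \<noteq> 0" "\<bar>of_int a\<bar> \<le> K / t ^ 3" "t > (0 :: real)"
  shows "t ^ 3 \<le> K" "t \<le> max 1 K"
proof -
  have "1 \<le> \<bar>real_of_int a\<bar>" using assms(1) by linarith
  then have "1 \<le> K / t ^ 3" using assms(2) by linarith
  then show t3: "t ^ 3 \<le> K" using assms(3) by (simp add: field_simps)
  show "t \<le> max 1 K"
  proof (cases "t \<le> 1")
    case False
    then have "t \<le> t ^ 3" using self_le_power[of t 3] by simp
    then show ?thesis using t3 by simp
  qed simp
qed

lemma finite_cusp_box:
  assumes "T > 0" "K > 0"
  shows "finite (cusp_box K T)"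
proof -
  let ?I = "\<lambda>A :: real. {m :: int. \<bar>of_int m\<bar> \<le> A}"
  have "cusp_box K T \<subseteq> ?I (K / T ^ 3) \<times> ?I (K / T) \<times> ?I (K * max 1 K)"
  proof
    fix x assume "x \<in> cusp_box K T"
    then obtain a b c t where x: "x = (a, b, c)" "a \<noteq> 0" "t \<ge> T" "\<bar>of_int a\<bar> \<le> K / t ^ 3"
      "\<bar>of_int b\<bar> \<le> K / t" "\<bar>of_int c\<bar> \<le> K * t" unfolding cusp_box_def by blast
    have t: "t \<le> max 1 K" using cusp_box_height x assms by simp
    have "K / t ^ 3 \<le> K / T ^ 3" "K / t \<le> K / T" using assms x(3)
      by (auto intro!: divide_left_mono power_mono mult_pos_pos)
    moreover have "K * t \<le> K * max 1 K" using t assms by (intro mult_left_mono) auto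
    ultimately show "x \<in> ?I (K / T ^ 3) \<times> ?I (K / T) \<times> ?I (K * max 1 K)"
      unfolding x(1) using x by auto
  qed
  moreover have "finite (?I (K / T ^ 3) \<times> ?I (K / T) \<times> ?I (K * max 1 K))"
    using assms by (intro finite_cartesian_product card_int_abs_le) auto
  ultimately show ?thesis by (rule finite_subset)
qed

text \<open>Each term is at most \<open>1 / (n - 1) - 1 / n\<close>; keeping the negative end term
  lets the induction telescope.\<close>

lemma sum_inverse_cubes_le:
  assumes "2 \<le> N" "N \<le> M"
  shows "(\<Sum>n = N..M. 1 / real n ^ 3) \<le> 1 / (real N - 1) - 1 / real M"
  using assms(2)
proof (induction M rule: nat_induct_at_least)
  case base
  define x where "x = real N"
  have "x \<ge> 2" using assms(1) by (simp add: x_def)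
  then have "x - 1 \<le> x\<^sup>2" by (smt (verit) self_le_power zero_less_numeral)
  then have "1 / x ^ 3 \<le> 1 / (x - 1) - 1 / x"
    using \<open>x \<ge> 2\<close> by (simp add: divide_simps power2_eq_square power3_eq_cube)
  then show ?case by (simp add: x_def)
next
  case (Suc M)
  define x where "x = real M"
  have x: "x \<ge> 2" using assms(1) Suc(1) by (simp add: x_def)
  have "1 / (x + 1) ^ 3 \<le> 1 / (x * (x + 1))"
  proof (rule divide_left_mono)
    have "x * (x + 1) * 1 \<le> (x + 1) * (x + 1) * (x + 1)" using x by (intro mult_mono) auto
    then show "x * (x + 1) \<le> (x + 1) ^ 3" by (simp add: power3_eq_cube)
  qed (use x in auto)
  also have "\<dots> = 1 / x - 1 / (x + 1)" using x by (simp add: field_simps)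
  finally have "1 / real (Suc M) ^ 3 \<le> 1 / real M - 1 / real (Suc M)"
    by (simp add: x_def add.commute)
  then show ?case using Suc by simp
qed

text \<open>The box is sliced according to \<open>n = nat \<lfloor>t\<rfloor>\<close>; each slice has \<open>O(K^3 / n^3)\<close> points because
  \<open>a \<noteq> 0\<close> forces \<open>n \<le> K\<close>, so that \<open>K / n\<close> absorbs the rounding errors.\<close>

lemma card_cusp_box:
  assumes "2 \<le> N" "K > 0"
  shows "real (card (cusp_box K (real N))) \<le> 30 * K ^ 3 / (real N - 1)"
proof -
  define A where "A = (\<lambda>n :: nat. {m :: int. m \<noteq> 0 \<and> \<bar>of_int m\<bar> \<le> K / real n ^ 3})"
  define B where "B = (\<lambda>n :: nat. {m :: int. \<bar>of_int m\<bar> \<le> K / real n})"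
  define C where "C = (\<lambda>n :: nat. {m :: int. \<bar>of_int m\<bar> \<le> K * (real n + 1)})"
  define M where "M = nat \<lfloor>K\<rfloor>"
  have fin: "finite (A n)" "finite (B n)" "finite (C n)" for n
  proof -
    show "finite (A n)" using card_int_abs_le(1)[of "K / real n ^ 3"] assms
      by (auto simp: A_def elim: rev_finite_subset)
  qed (use assms card_int_abs_le(1) in \<open>auto simp: B_def C_def\<close>)
  have sub: "cusp_box K (real N) \<subseteq> (\<Union>n\<in>{N..M}. A n \<times> B n \<times> C n)"
  proof
    fix x assume "x \<in> cusp_box K (real N)"
    then obtain a b c t where x: "x = (a, b, c)" "a \<noteq> 0" "t \<ge> real N" "\<bar>of_int a\<bar> \<le> K / t ^ 3"
      "\<bar>of_int b\<bar> \<le> K / t" "\<bar>of_int c\<bar> \<le> K * t" unfolding cusp_box_def by blast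
    define n where "n = nat \<lfloor>t\<rfloor>"
    have t2: "t \<ge> 2" using x(3) assms by simp
    have n: "real n \<le> t" "t < real n + 1" "N \<le> n" using x(3) t2 by (simp_all add: n_def le_nat_floor)
    have n2: "n \<ge> 2" using n(3) assms by simp
    have "t \<le> max 1 K" using cusp_box_height x t2 by simp
    \<comment> \<open>As \<open>t \<ge> 2\<close>, the maximum must be \<open>K\<close>.\<close>
    then have "n \<le> M" using n(1) t2 unfolding M_def by (intro le_nat_floor) linarith
    have "K / t ^ 3 \<le> K / real n ^ 3" "K / t \<le> K / real n" using assms n n2 t2
      by (auto intro!: divide_left_mono power_mono mult_pos_pos)
    moreover have "K * t \<le> K * (real n + 1)" using n assms by (intro mult_left_mono) auto
    ultimately have "x \<in> A n \<times> B n \<times> C n" unfolding x(1) A_def B_def C_def using x by auto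
    then show "x \<in> (\<Union>n\<in>{N..M}. A n \<times> B n \<times> C n)" using n(3) \<open>n \<le> M\<close> by auto
  qed
  have slice: "real (card (A n \<times> B n \<times> C n)) \<le> 30 * K ^ 3 * (1 / real n ^ 3)" if "n \<in> {N..M}" for n
  proof -
    have n2: "real n \<ge> 2" using that assms by simp
    have "real n \<le> of_int \<lfloor>K\<rfloor>" using that n2 unfolding M_def by auto
    then have nK: "real n \<le> K" by linarith
    \<comment> \<open>The factor \<open>30\<close> is \<open>2 * 3 * 5\<close>, one factor for each
      coefficient; the rounding terms of \<open>B\<close> and \<open>C\<close> are absorbed by
      \<open>n \<le> K\<close> and \<open>2 \<le> n\<close>.\<close>
    have a: "real (card (A n)) \<le> 2 * (K / real n ^ 3)"
      unfolding A_def using assms by (intro card_int_abs_le) auto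
    have "real (card (B n)) \<le> 2 * (K / real n) + 1"
      unfolding B_def using assms by (intro card_int_abs_le) auto
    moreover have "1 \<le> K / real n" using nK n2 by simp
    ultimately have b: "real (card (B n)) \<le> 3 * (K / real n)" by linarith
    have "real (card (C n)) \<le> 2 * (K * (real n + 1)) + 1"
      unfolding C_def using assms by (intro card_int_abs_le) auto
    moreover have "K * 2 \<le> K * real n" using n2 assms by (intro mult_left_mono) auto
    moreover have "K \<ge> 2" using n2 nK by simp
    moreover have "K * (real n + 1) = K * real n + K" by (simp add: algebra_simps)
    ultimately have c: "real (card (C n)) \<le> 5 * (K * real n)" by linarith
    have "real (card (A n \<times> B n \<times> C n)) = real (card (A n)) * (real (card (B n)) * real (card (C n)))"
      by (simp add: card_cartesian_product)
    also have "\<dots> \<le> 2 * (K / real n ^ 3) * (3 * (K / real n) * (5 * (K * real n)))"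
      using assms by (intro mult_mono a b c) auto
    also have "\<dots> = 30 * K ^ 3 * (1 / real n ^ 3)"
      using n2 by (simp add: power3_eq_cube)
    finally show ?thesis .
  qed
  have "real (card (cusp_box K (real N))) \<le> real (card (\<Union>n\<in>{N..M}. A n \<times> B n \<times> C n))"
    using sub fin by (intro of_nat_mono card_mono) auto
  also have "\<dots> \<le> (\<Sum>n\<in>{N..M}. real (card (A n \<times> B n \<times> C n)))"
    unfolding of_nat_sum[symmetric] by (intro of_nat_mono card_UN_le) simp
  also have "\<dots> \<le> (\<Sum>n\<in>{N..M}. 30 * K ^ 3 * (1 / real n ^ 3))"
    by (intro sum_mono slice)
  also have "\<dots> = 30 * K ^ 3 * (\<Sum>n\<in>{N..M}. 1 / real n ^ 3)" by (simp add: sum_distrib_left)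
  also have "\<dots> \<le> 30 * K ^ 3 * (1 / (real N - 1))"
  proof (intro mult_left_mono)
    show "(\<Sum>n\<in>{N..M}. 1 / real n ^ 3) \<le> 1 / (real N - 1)"
    proof (cases "N \<le> M")
      case True
      then show ?thesis using sum_inverse_cubes_le[OF assms(1) True] by (smt (verit) of_nat_0_le_iff divide_nonneg_nonneg)
    qed (use assms in auto)
  qed (use assms in auto)
  finally show ?thesis by simp
qed

section \<open>The lower bound\<close>

text \<open>The index set of the sum in \<open>count_forms\<close>, that is, the forms without their
  multiplicities.\<close>

definition form_set ::
  "(real ^ 2 ^ 2) set \<Rightarrow> nat \<Rightarrow> real bcubic \<Rightarrow> int \<times> int \<Rightarrow> real \<Rightarrow> real \<Rightarrow> real \<Rightarrow> real bcubic set" where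
  "form_set G i v P c1 c2 X = {f \<in> (\<lambda>g. bc_act g v) ` G \<inter> V_int_irr i.
     bc_eval f (vector [of_int (fst P), of_int (snd P)]) = 1 \<and>
     c1 * X \<le> \<bar>bc_disc f\<bar> \<and> \<bar>bc_disc f\<bar> < c2 * X}"

lemma V_real_act:
  assumes "v \<in> V_real i" "bc_disc (bc_act g v) \<noteq> 0"
  shows "bc_act g v \<in> V_real i"
proof -
  have "det g \<noteq> 0" using assms(2) by (auto simp: bc_disc_act)
  then show ?thesis using assms(1)
    by (auto simp: V_real_def bc_disc_act zero_less_mult_iff mult_less_0_iff split: if_splits)
qed

text \<open>The integral forms with value \<open>1\<close> at \<open>P\<close> differ by multiples
  of \<open>\<beta> X - \<alpha> Y\<close>. Even multiples keep the parity pattern, and the three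
  coefficients of the quadratic cofactor range over intervals of length proportional to
  \<open>L\<close>.\<close>

lemma form_set_card_ge:
  assumes \<nu>: "gauss_sections \<nu>" and v: "v \<in> V_real i" "bc_disc v \<noteq> 0"
    and cop: "coprime \<alpha> \<beta>" and \<beta>: "\<beta> \<noteq> 0" and c: "0 < c1" "c1 < c2"
  obtains C L0 where "C > 0" "L0 > 0"
    "\<And>L. L \<ge> L0 \<Longrightarrow> \<exists>S \<subseteq> form_set (fund_dom \<nu>) i v (\<alpha>, \<beta>) c1 c2 (L ^ 4). C * L ^ 3 \<le> real (card S)"
proof -
  define x y where "x = real_of_int \<alpha>" and "y = real_of_int \<beta>"
  have y0: "y \<noteq> 0" using \<beta> by (simp add: y_def)
  obtain f \<delta> where f: "subst_a f x y = 0" and \<delta>: "\<delta> > 0"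
    and box: "\<And>h. near \<delta> f h \<Longrightarrow> h \<in> (\<lambda>g. bc_act g v) ` fund_dom \<nu> \<and> c1 < \<bar>bc_disc h\<bar> \<and> \<bar>bc_disc h\<bar> < c2"
    using orbit_contains_box_disc[OF \<nu> v(2) y0 c] by metis
  \<comment> \<open>Since \<open>f\<close> vanishes at \<open>(x, y)\<close>, it factors as
    \<open>(y X - x Y) (q1 X^2 + q2 X Y + q3 Y^2)\<close>.\<close>
  define q1 where "q1 = cf_a f / y"
  define q2 where "q2 = (cf_b f + x * q1) / y"
  define q3 where "q3 = (cf_c f + x * q2) / y"
  have fa: "cf_a f = y * q1" and fb: "cf_b f = y * q2 - x * q1" and fc: "cf_c f = y * q3 - x * q2"
    using y0 by (simp_all add: q1_def q2_def q3_def)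
  have "(cf_d f + x * q3) * y ^ 3 = 0" using f unfolding subst_a_def fa fb fc by algebra
  then have fd: "cf_d f = - x * q3" using y0 by simp
  obtain a b c d where odd: "odd a" "odd d" "odd (b + c)"
    and P1: "a * \<alpha> ^ 3 + b * \<alpha>\<^sup>2 * \<beta> + c * \<alpha> * \<beta>\<^sup>2 + d * \<beta> ^ 3 = 1"
    using odd_form_exists[OF cop] .
  \<comment> \<open>the forms \<open>(a, b, c, d) + 2 (\<beta> X - \<alpha> Y) (m X^2 + n X Y + l Y^2)\<close>\<close>
  define F where "F = (\<lambda>(m, n, l). BCubic (real_of_int (a + 2 * \<beta> * m)) (of_int (b + 2 * (\<beta> * n - \<alpha> * m)))
     (of_int (c + 2 * (\<beta> * l - \<alpha> * n))) (of_int (d - 2 * \<alpha> * l)))"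
  have injF: "inj_on F A" for A using \<beta> by (auto simp: inj_on_def F_def)
  define Z where "Z = \<bar>x\<bar> + \<bar>y\<bar>"
  \<comment> \<open>Changing the cofactor by less than \<open>\<epsilon>\<close> in each coefficient
    moves the form by less than \<open>\<delta> / 2\<close>; the other half is reserved for the
    fixed odd form divided by \<open>L\<close>.\<close>
  define \<epsilon> where "\<epsilon> = \<delta> / 2 / Z"
  have "Z > 0" using y0 by (simp add: Z_def)
  then have \<epsilon>: "\<epsilon> > 0" "Z * \<epsilon> = \<delta> / 2" using \<delta> by (simp_all add: \<epsilon>_def)
  define s where "s = \<bar>real_of_int a\<bar> + \<bar>real_of_int b\<bar> + \<bar>real_of_int c\<bar> + \<bar>real_of_int d\<bar>"
  \<comment> \<open>The second summand makes \<open>L * \<epsilon> - 1\<close> at least half of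
    \<open>L * \<epsilon>\<close>; the third brings the odd form divided by \<open>L\<close> within
    \<open>\<delta> / 2\<close>.\<close>
  define L0 where "L0 = 1 + 2 / \<epsilon> + 2 * s / \<delta>"
  define J where "J = (\<lambda>L q. {m :: int. L * (q - \<epsilon>) / 2 < of_int m \<and> of_int m < L * (q - \<epsilon>) / 2 + L * \<epsilon>})"
  have s0: "s \<ge> 0" by (simp add: s_def)
  have L0: "L0 > 0" unfolding L0_def using \<epsilon> \<delta> s0 by (intro add_pos_nonneg) auto
  have Jcard: "\<epsilon> / 2 * L \<le> real (card (J L q))" if "L \<ge> L0" for L q
  proof -
    have "2 / \<epsilon> \<le> L" using that s0 \<delta> unfolding L0_def by (smt (verit) divide_nonneg_pos)
    then have "1 \<le> L * \<epsilon> / 2" using \<epsilon> by (simp add: field_simps)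
    moreover have "L * \<epsilon> - 1 \<le> real (card (J L q))" unfolding J_def by (rule card_int_open_interval)
    moreover have "\<epsilon> / 2 * L = L * \<epsilon> / 2" by simp
    ultimately show ?thesis by linarith
  qed
  have Jnear: "\<bar>2 * (of_int m / L) - q\<bar> < \<epsilon>" if "m \<in> J L q" "L > 0" for L q m
  proof -
    define z where "z = real_of_int m / L"
    have "(q - \<epsilon>) / 2 < z" "z < (q + \<epsilon>) / 2"
      using that by (simp_all add: J_def z_def field_simps)
    then show ?thesis unfolding z_def[symmetric] abs_less_iff by (simp add: field_simps)
  qed
  have F_in: "F (m, n, l) \<in> form_set (fund_dom \<nu>) i v (\<alpha>, \<beta>) c1 c2 (L ^ 4)"
    if L: "L \<ge> L0" and mem: "m \<in> J L q1" "n \<in> J L q2" "l \<in> J L q3" for L m n l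
  proof -
    define g where "g = F (m, n, l)"
    have L1: "L > 0" using L L0 by simp
    have small: "\<bar>of_int e / L\<bar> \<le> \<delta> / 2" if "\<bar>real_of_int e\<bar> \<le> s" for e
    proof -
      have "2 * s / \<delta> \<le> L" using L \<epsilon>(1) unfolding L0_def by (smt (verit) divide_pos_pos)
      then have "s \<le> L * (\<delta> / 2)" using \<delta> by (simp add: field_simps)
      then show ?thesis using that L1 by (simp add: field_simps)
    qed
    define M N K where "M = 2 * (of_int m / L) - q1" and "N = 2 * (of_int n / L) - q2"
      and "K = 2 * (of_int l / L) - q3"
    have MNK: "\<bar>M\<bar> < \<epsilon>" "\<bar>N\<bar> < \<epsilon>" "\<bar>K\<bar> < \<epsilon>"
      unfolding M_def N_def K_def using Jnear mem L1 by blast+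
    have bound: "\<bar>of_int e / L + (y * U - x * V)\<bar> < \<delta>" if "\<bar>real_of_int e\<bar> \<le> s" "\<bar>U\<bar> < \<epsilon>" "\<bar>V\<bar> < \<epsilon>" for e U V
    proof -
      have "\<bar>y * U\<bar> < \<bar>y\<bar> * \<epsilon>" using that(2) y0 by (simp add: abs_mult)
      moreover have "\<bar>x * V\<bar> \<le> \<bar>x\<bar> * \<epsilon>" using that(3) by (simp add: abs_mult mult_left_mono)
      moreover have "\<bar>x\<bar> * \<epsilon> + \<bar>y\<bar> * \<epsilon> = \<delta> / 2" using \<epsilon>(2) by (simp add: Z_def algebra_simps)
      ultimately show ?thesis using small[OF that(1)] by linarith
    qed
    have bound': "\<bar>of_int e / L - x * V\<bar> < \<delta>" if "\<bar>real_of_int e\<bar> \<le> s" "\<bar>V\<bar> < \<epsilon>" for e V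
      using bound[OF that(1) _ that(2), of 0] \<epsilon>(1) by simp
    \<comment> \<open>The term \<open>x * 0\<close> gives the first difference the shape required by
      \<open>bound\<close>.\<close>
    have eqs: "(1 / L) * cf_a g - cf_a f = of_int a / L + (y * M - x * 0)"
      "(1 / L) * cf_b g - cf_b f = of_int b / L + (y * N - x * M)"
      "(1 / L) * cf_c g - cf_c f = of_int c / L + (y * K - x * N)"
      "(1 / L) * cf_d g - cf_d f = of_int d / L - x * K"
      unfolding g_def F_def fa fb fc fd M_def N_def K_def using L1
      by (simp_all add: field_simps flip: x_def y_def)
    have "near \<delta> f (bc_scale (1 / L) g)"
      unfolding near_def bc_scale_sel eqs
      by (intro conjI bound bound' MNK) (use \<epsilon>(1) in \<open>simp_all add: s_def\<close>)
    note h = box[OF this]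
    have g_eq: "bc_scale L (bc_scale (1 / L) g) = g" using L1 by (simp add: bc_eq_iff)
    have orb: "g \<in> (\<lambda>g. bc_act g v) ` fund_dom \<nu>"
      using scale_in_orbit[OF conjunct1[OF h] L1] unfolding g_eq .
    have "\<bar>bc_disc g\<bar> = L ^ 4 * \<bar>bc_disc (bc_scale (1 / L) g)\<bar>"
      using bc_disc_scale[of L "bc_scale (1 / L) g"] unfolding g_eq by (simp add: abs_mult)
    moreover have "L ^ 4 > 0" using L1 by simp
    ultimately have disc: "c1 * L ^ 4 < \<bar>bc_disc g\<bar>" "\<bar>bc_disc g\<bar> < c2 * L ^ 4"
      using h by (simp_all add: mult.commute[of _ "L ^ 4"])
    then have "bc_disc g \<noteq> 0" using assms(6) \<open>L ^ 4 > 0\<close> by (smt (verit) mult_pos_pos)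
    then have "g \<in> V_real i" using orb V_real_act v(1) by blast
    moreover have "set_bcubic g \<subseteq> \<int>" by (simp add: g_def F_def)
    moreover have "irreducible_over_rat g" unfolding g_def F_def prod.case
      by (rule irreducible_over_rat_odd) (use odd in auto)
    moreover have "bc_eval g (vector [of_int \<alpha>, of_int \<beta>]) = 1"
    proof -
      have "bc_eval g (vector [of_int \<alpha>, of_int \<beta>])
          = of_int (a * \<alpha> ^ 3 + b * \<alpha>\<^sup>2 * \<beta> + c * \<alpha> * \<beta>\<^sup>2 + d * \<beta> ^ 3)"
        unfolding bc_eval_subst subst_a_def g_def F_def prod.case bcubic.sel
          of_int_add of_int_mult of_int_power of_int_diff of_int_numeral by algebra
      then show ?thesis unfolding P1 by simp
    qed
    ultimately show ?thesis using orb disc unfolding form_set_def V_int_irr_def V_int_def g_def by simp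
  qed
  show thesis
  proof (rule that[of "(\<epsilon> / 2) ^ 3" L0])
    fix L assume L: "L \<ge> L0"
    define S where "S = F ` (J L q1 \<times> J L q2 \<times> J L q3)"
    have sub: "S \<subseteq> form_set (fund_dom \<nu>) i v (\<alpha>, \<beta>) c1 c2 (L ^ 4)"
      unfolding S_def by (rule image_subsetI) (clarify, rule F_in[OF L])
    have "(\<epsilon> / 2) ^ 3 * L ^ 3 = \<epsilon> / 2 * L * (\<epsilon> / 2 * L * (\<epsilon> / 2 * L))" by (simp add: power3_eq_cube)
    also have "\<dots> \<le> real (card (J L q1)) * (real (card (J L q2)) * real (card (J L q3)))"
      using L L0 \<epsilon>(1) by (intro mult_mono Jcard mult_nonneg_nonneg) auto
    also have "\<dots> = real (card S)"
      unfolding S_def card_image[OF injF] by (simp add: card_cartesian_product)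
    finally show "\<exists>S \<subseteq> form_set (fund_dom \<nu>) i v (\<alpha>, \<beta>) c1 c2 (L ^ 4). (\<epsilon> / 2) ^ 3 * L ^ 3 \<le> real (card S)"
      by (intro exI[of _ S] conjI sub)
  qed (use \<epsilon> L0 in auto)
qed

section \<open>The upper bound in the cusp\<close>

definition coeff_sum :: "real bcubic \<Rightarrow> real" where
  "coeff_sum f = \<bar>cf_a f\<bar> + \<bar>cf_b f\<bar> + \<bar>cf_c f\<bar> + \<bar>cf_d f\<bar>"

lemma abs_mult3_le:
  fixes x y z :: real
  assumes "\<bar>x\<bar> \<le> X" "\<bar>y\<bar> \<le> Y" "\<bar>z\<bar> \<le> Z"
  shows "\<bar>x * y * z\<bar> \<le> X * Y * Z"
  unfolding abs_mult using assms by (intro mult_mono mult_nonneg_nonneg) auto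

lemma subst_a_bound:
  assumes "\<bar>p\<bar> \<le> P" "\<bar>q\<bar> \<le> P"
  shows "\<bar>subst_a f p q\<bar> \<le> coeff_sum f * P ^ 3"
proof -
  have *: "\<bar>k * (x * y * z)\<bar> \<le> \<bar>k\<bar> * (P * P * P)" if "\<bar>x\<bar> \<le> P" "\<bar>y\<bar> \<le> P" "\<bar>z\<bar> \<le> P" for k x y z
    unfolding abs_mult[of k] using that by (intro mult_left_mono abs_mult3_le) auto
  have "subst_a f p q = cf_a f * (p * p * p) + cf_b f * (p * p * q) + cf_c f * (p * q * q) + cf_d f * (q * q * q)"
    by (simp add: subst_a_def power2_eq_square power3_eq_cube)
  moreover have "coeff_sum f * P ^ 3 = \<bar>cf_a f\<bar> * (P * P * P) + \<bar>cf_b f\<bar> * (P * P * P)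
      + \<bar>cf_c f\<bar> * (P * P * P) + \<bar>cf_d f\<bar> * (P * P * P)"
    by (simp add: coeff_sum_def power3_eq_cube algebra_simps)
  moreover have "\<bar>w + x + y + z\<bar> \<le> W + X + Y + Z"
    if "\<bar>w\<bar> \<le> W" "\<bar>x\<bar> \<le> X" "\<bar>y\<bar> \<le> Y" "\<bar>z\<bar> \<le> Z" for w x y z W X Y Z :: real
    using that unfolding abs_le_iff by linarith
  ultimately show ?thesis using * assms by presburger
qed

lemma subst_b_bound:
  assumes "\<bar>p\<bar> \<le> P" "\<bar>q\<bar> \<le> P" "\<bar>r\<bar> \<le> R" "\<bar>s\<bar> \<le> R"
  shows "\<bar>subst_b f p q r s\<bar> \<le> 3 * coeff_sum f * P\<^sup>2 * R"
proof -
  have *: "\<bar>k * (x * y * z)\<bar> \<le> \<bar>k\<bar> * (P * P * R)" if "\<bar>x\<bar> \<le> P" "\<bar>y\<bar> \<le> P" "\<bar>z\<bar> \<le> R" for k x y z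
    unfolding abs_mult[of k] using that by (intro mult_left_mono abs_mult3_le) auto
  have "subst_b f p q r s = 3 * (cf_a f * (p * p * r)) + 2 * (cf_b f * (p * q * r)) + cf_b f * (p * p * s)
      + 2 * (cf_c f * (p * q * s)) + cf_c f * (q * q * r) + 3 * (cf_d f * (q * q * s))"
    by (simp add: subst_b_def power2_eq_square algebra_simps)
  moreover have "3 * coeff_sum f * P\<^sup>2 * R = 3 * (\<bar>cf_a f\<bar> * (P * P * R)) + 3 * (\<bar>cf_b f\<bar> * (P * P * R))
      + 3 * (\<bar>cf_c f\<bar> * (P * P * R)) + 3 * (\<bar>cf_d f\<bar> * (P * P * R))"
    by (simp add: coeff_sum_def power2_eq_square algebra_simps)
  moreover have "\<bar>3 * w + 2 * x + x' + 2 * y + y' + 3 * z\<bar> \<le> 3 * W + 3 * X + 3 * Y + 3 * Z"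
    if "\<bar>w\<bar> \<le> W" "\<bar>x\<bar> \<le> X" "\<bar>x'\<bar> \<le> X" "\<bar>y\<bar> \<le> Y" "\<bar>y'\<bar> \<le> Y" "\<bar>z\<bar> \<le> Z"
    for w x x' y y' z W X Y Z :: real
    using that unfolding abs_le_iff by linarith
  ultimately show ?thesis using * assms by presburger
qed

text \<open>The rows of the matrix have sizes \<open>s / t\<close> and at most
  \<open>2 * s * t\<close>, and its determinant is \<open>s ^ 2\<close>. The coefficients
  \<open>a\<close>, \<open>b\<close>, \<open>c\<close> have degrees 3, 2, 1 in the first row and 0,
  1, 2 in the second; \<open>c\<close> needs the constant \<open>12\<close>.\<close>

lemma fund_dom_coeffs:
  assumes u: "\<bar>u\<bar> \<le> 1 / 2" and t: "t_zero \<le> t" and k: "rotation_matrix k" and s: "s > 0"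
    and f: "f = bc_act (n_mat u ** a_mat t ** k ** mat s) v"
  shows "\<bar>cf_a f\<bar> \<le> 12 * coeff_sum v * s / t ^ 3"
    and "\<bar>cf_b f\<bar> \<le> 12 * coeff_sum v * s / t"
    and "\<bar>cf_c f\<bar> \<le> 12 * coeff_sum v * s * t"
    and "bc_disc f = s ^ 4 * bc_disc v"
proof -
  have t0: "t > 0" using t t_zero_bounds by simp
  have "t_zero\<^sup>2 \<le> t\<^sup>2" using t t_zero_bounds by (intro power_mono) auto
  then have t2: "1 / 2 \<le> t\<^sup>2" using t_zero_bounds by linarith
  obtain k1 k2 k3 k4 where k_eq: "k = mat2 k1 k2 k3 k4" by (rule mat2_cases)
  have kk: "k1 * k1 + k2 * k2 = 1" "k3 * k3 + k4 * k4 = 1" "k1 * k4 - k2 * k3 = 1"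
    using k unfolding rotation_matrix_def orthogonal_matrix_def k_eq transpose_mat2 mat2_mult mat_eq_mat2
    by (simp_all add: mat2_eq_iff)
  have le1: "\<bar>z\<bar> \<le> 1 \<and> \<bar>w\<bar> \<le> 1" if "z * z + w * w = 1" for z w :: real
  proof -
    have "z\<^sup>2 + w\<^sup>2 = 1" using that by (simp add: power2_eq_square)
    then have "z\<^sup>2 \<le> 1" "w\<^sup>2 \<le> 1" using zero_le_power2[of z] zero_le_power2[of w] by linarith+
    then show ?thesis by (simp add: abs_square_le_1)
  qed
  have k_le: "\<bar>k1\<bar> \<le> 1" "\<bar>k2\<bar> \<le> 1" "\<bar>k3\<bar> \<le> 1" "\<bar>k4\<bar> \<le> 1" using le1 kk by blast+
  define p q r w where "p = s / t * k1" and "q = s / t * k2"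
    and "r = s * (u / t * k1 + t * k3)" and "w = s * (u / t * k2 + t * k4)"
  have g: "n_mat u ** a_mat t ** k ** mat s = mat2 p q r w"
    unfolding n_mat_mat2 a_mat_mat2 k_eq mat_eq_mat2 mat2_mult p_def q_def r_def w_def
    by (simp add: mat2_eq_iff field_simps)
  have "p * w - q * r = s\<^sup>2 * (k1 * k4 - k2 * k3)"
    unfolding p_def q_def r_def w_def using t0 by (simp add: field_simps power2_eq_square)
  then have det: "p * w - q * r = s\<^sup>2" using kk by simp
  have P: "\<bar>p\<bar> \<le> s / t" "\<bar>q\<bar> \<le> s / t"
    using mult_left_le[of "\<bar>k1\<bar>" "s / t"] mult_left_le[of "\<bar>k2\<bar>" "s / t"] k_le s t0
    by (simp_all add: p_def q_def abs_mult)
  have lower: "\<bar>s * (u / t * z + t * z')\<bar> \<le> 2 * s * t" if "\<bar>z\<bar> \<le> 1" "\<bar>z'\<bar> \<le> 1" for z z'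
  proof -
    have "\<bar>u / t * z\<bar> \<le> 1 / 2 / t * 1"
      unfolding abs_mult abs_divide using u t0 that by (intro mult_mono divide_mono) auto
    \<comment> \<open>This is where the lower bound on \<open>t_zero\<close> enters, as
      \<open>t ^ 2 \<ge> 1 / 2\<close>.\<close>
    also have "\<dots> \<le> t" using t0 t2 by (simp add: field_simps power2_eq_square)
    finally have "\<bar>u / t * z\<bar> \<le> t" .
    moreover have "\<bar>t * z'\<bar> \<le> t" using t0 that by (simp add: abs_mult mult_left_le)
    ultimately have "\<bar>u / t * z + t * z'\<bar> \<le> 2 * t" by linarith
    then show ?thesis using s by (simp add: abs_mult)
  qed
  have R: "\<bar>r\<bar> \<le> 2 * s * t" "\<bar>w\<bar> \<le> 2 * s * t" unfolding r_def w_def using lower k_le by blast+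
  have fe: "cf_a f = subst_a v p q / s\<^sup>2" "cf_b f = subst_b v p q r w / s\<^sup>2" "cf_c f = subst_b v r w p q / s\<^sup>2"
    unfolding f g bc_act_mat2 det bc_scale_sel subst_form_def by simp_all
  have m0: "coeff_sum v \<ge> 0" by (simp add: coeff_sum_def)
  have "\<bar>cf_a f\<bar> \<le> coeff_sum v * (s / t) ^ 3 / s\<^sup>2"
    unfolding fe abs_divide using s by (simp add: divide_right_mono subst_a_bound[OF P])
  also have "\<dots> = coeff_sum v * s / t ^ 3" using s t0 by (simp add: field_simps power2_eq_square power3_eq_cube)
  also have "\<dots> \<le> 12 * coeff_sum v * s / t ^ 3" using m0 s t0 by (intro divide_right_mono mult_right_mono) auto
  finally show "\<bar>cf_a f\<bar> \<le> 12 * coeff_sum v * s / t ^ 3" .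
  have "\<bar>cf_b f\<bar> \<le> 3 * coeff_sum v * (s / t)\<^sup>2 * (2 * s * t) / s\<^sup>2"
    unfolding fe abs_divide using divide_right_mono[OF subst_b_bound[OF P R, of v], of "s\<^sup>2"] by simp
  also have "\<dots> = 6 * coeff_sum v * s / t" using s t0 by (simp add: field_simps power2_eq_square power3_eq_cube)
  also have "\<dots> \<le> 12 * coeff_sum v * s / t" using m0 s t0 by (intro divide_right_mono mult_right_mono) auto
  finally show "\<bar>cf_b f\<bar> \<le> 12 * coeff_sum v * s / t" .
  have "\<bar>cf_c f\<bar> \<le> 3 * coeff_sum v * (2 * s * t)\<^sup>2 * (s / t) / s\<^sup>2"
    unfolding fe abs_divide using divide_right_mono[OF subst_b_bound[OF R P, of v], of "s\<^sup>2"] by simp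
  also have "\<dots> = 12 * coeff_sum v * s * t" using s t0 by (simp add: field_simps power2_eq_square power3_eq_cube)
  finally show "\<bar>cf_c f\<bar> \<le> 12 * coeff_sum v * s * t" .
  show "bc_disc f = s ^ 4 * bc_disc v"
    unfolding f g bc_disc_act det_mat2 det by simp
qed

section \<open>Integral forms as points of the cusp box\<close>

definition coords :: "real bcubic \<Rightarrow> int \<times> int \<times> int" where
  "coords f = (\<lfloor>cf_a f\<rfloor>, \<lfloor>cf_b f\<rfloor>, \<lfloor>cf_c f\<rfloor>)"

lemma form_set_int:
  assumes "f \<in> form_set G i v P c1 c2 X"
  shows "of_int \<lfloor>cf_a f\<rfloor> = cf_a f" "of_int \<lfloor>cf_b f\<rfloor> = cf_b f" "of_int \<lfloor>cf_c f\<rfloor> = cf_c f"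
    "of_int \<lfloor>cf_d f\<rfloor> = cf_d f" "bc_disc f \<noteq> 0" "cf_a f \<noteq> 0"
proof -
  have f: "f \<in> V_real i" "set_bcubic f \<subseteq> \<int>" "irreducible_over_rat f"
    using assms by (auto simp: form_set_def V_int_irr_def V_int_def)
  show "of_int \<lfloor>cf_a f\<rfloor> = cf_a f" "of_int \<lfloor>cf_b f\<rfloor> = cf_b f" "of_int \<lfloor>cf_c f\<rfloor> = cf_c f"
    "of_int \<lfloor>cf_d f\<rfloor> = cf_d f"
    using f(2) by (cases f; auto simp: of_int_floor_cancel elim!: Ints_cases)+
  show "bc_disc f \<noteq> 0" using f(1) by (auto simp: V_real_def split: if_splits)
  then show "cf_a f \<noteq> 0" using f(3) irreducible_cf_a_nonzero by blast
qed

text \<open>The condition \<open>f(P) = 1\<close> determines \<open>d\<close> from \<open>a, b, c\<close> as the second coordinate of \<open>P\<close> is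
  nonzero.\<close>

lemma inj_on_coords:
  assumes "\<beta> \<noteq> 0"
  shows "inj_on coords (form_set G i v (\<alpha>, \<beta>) c1 c2 X)"
proof (rule inj_onI)
  fix f h assume f: "f \<in> form_set G i v (\<alpha>, \<beta>) c1 c2 X" and h: "h \<in> form_set G i v (\<alpha>, \<beta>) c1 c2 X"
    and eq: "coords f = coords h"
  have abc: "cf_a f = cf_a h" "cf_b f = cf_b h" "cf_c f = cf_c h"
    using eq form_set_int[OF f] form_set_int[OF h] by (metis coords_def prod.inject)+
  have "subst_a f (of_int \<alpha>) (of_int \<beta>) = 1" "subst_a h (of_int \<alpha>) (of_int \<beta>) = 1"
    using f h by (simp_all add: form_set_def bc_eval_subst)
  then have "cf_d f * of_int \<beta> ^ 3 = cf_d h * of_int \<beta> ^ 3" unfolding subst_a_def abc by linarith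
  then show "f = h" using abc assms by (simp add: bc_eq_iff)
qed

text \<open>The discriminant is \<open>s ^ 4\<close> times that of \<open>v\<close>, so its upper
  bound limits \<open>s\<close> to a constant multiple of \<open>L\<close>, and
  \<open>fund_dom_coeffs\<close> takes the shape of the box.\<close>

lemma coords_in_cusp_box:
  assumes \<nu>: "gauss_sections \<nu>" and v: "bc_disc v \<noteq> 0" and c2: "0 < c2"
  obtains K where "K > 0"
    "\<And>T L. \<lbrakk>T > 0; L > 0\<rbrakk> \<Longrightarrow>
       coords ` form_set (fund_dom_cusp \<nu> T) i v P c1 c2 (L ^ 4) \<subseteq> cusp_box (K * L) T"
proof -
  define e where "e = c2 / \<bar>bc_disc v\<bar>"
  define k where "k = root 4 e"
  have "e > 0" using v c2 by (simp add: e_def)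
  then have k: "k > 0" "k ^ 4 = e" by (simp_all add: k_def)
  have "cf_a v \<noteq> 0 \<or> cf_b v \<noteq> 0 \<or> cf_c v \<noteq> 0 \<or> cf_d v \<noteq> 0" using v by (auto simp: bc_disc_sel)
  then have m: "coeff_sum v > 0" unfolding coeff_sum_def by (smt (verit))
  define K where "K = 12 * coeff_sum v * k"
  show thesis
  proof (rule that[of K])
    show "K > 0" using m k by (simp add: K_def)
    fix T L :: real assume T: "T > 0" and L: "L > 0"
    show "coords ` form_set (fund_dom_cusp \<nu> T) i v P c1 c2 (L ^ 4) \<subseteq> cusp_box (K * L) T"
    proof
      fix x assume "x \<in> coords ` form_set (fund_dom_cusp \<nu> T) i v P c1 c2 (L ^ 4)"
      then obtain f where x: "x = coords f" and f: "f \<in> form_set (fund_dom_cusp \<nu> T) i v P c1 c2 (L ^ 4)"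
        by blast
      obtain u t r s where g: "f = bc_act (n_mat u ** a_mat t ** r ** mat s) v" "u \<in> \<nu> t" "t_zero \<le> t"
        "rotation_matrix r" "s > 0" "t > T"
        using f unfolding form_set_def fund_dom_cusp_def by blast
      have "u \<in> nu_closed t" using \<nu> g(2,3) by (auto simp: gauss_sections_def)
      then have u: "\<bar>u\<bar> \<le> 1 / 2" by (simp add: nu_closed_def)
      note b = fund_dom_coeffs[OF u g(3,4,5,1)]
      have "s ^ 4 * \<bar>bc_disc v\<bar> < c2 * L ^ 4"
        using f b(4) g(5) by (simp add: form_set_def abs_mult)
      then have "s ^ 4 < e * L ^ 4" using v by (simp add: e_def field_simps)
      then have "s ^ 4 < (k * L) ^ 4" by (simp add: power_mult_distrib k)
      then have "s < k * L" using k L by (intro power_less_imp_less_base[of s 4]) auto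
      then have sK: "12 * coeff_sum v * s \<le> K * L" using m by (simp add: K_def mult_left_mono)
      have t: "t > 0" using T g(6) by simp
      have "\<bar>cf_a f\<bar> \<le> K * L / t ^ 3" "\<bar>cf_b f\<bar> \<le> K * L / t" "\<bar>cf_c f\<bar> \<le> K * L * t"
        using b(1-3) sK t by (meson order.trans divide_right_mono mult_right_mono less_imp_le zero_less_power)+
      then show "x \<in> cusp_box (K * L) T"
        unfolding x coords_def cusp_box_def using form_set_int[OF f] g(6)
        by (auto intro!: exI[of _ t])
    qed
  qed
qed

text \<open>As \<open>1 / 2\<close> lies below \<open>t_zero\<close>, the whole domain counts as a
  cusp, so the box bound also gives finiteness of the full count.\<close>

lemma fund_dom_eq_cusp: "fund_dom \<nu> = fund_dom_cusp \<nu> (1 / 2)"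
proof -
  have "1 / 2 < t" if "t_zero \<le> t" for t
  proof (rule ccontr)
    assume "\<not> 1 / 2 < t"
    then have "t_zero\<^sup>2 \<le> (1 / 2)\<^sup>2" using that t_zero_bounds by (intro power_mono) auto
    then show False using t_zero_bounds(2) by (simp add: power2_eq_square)
  qed
  then show ?thesis unfolding fund_dom_def fund_dom_cusp_def by blast
qed

lemma cusp_box_mono: "S \<le> T \<Longrightarrow> cusp_box K T \<subseteq> cusp_box K S"
  unfolding cusp_box_def by (auto intro: order.trans)

section \<open>From forms to counts with multiplicity\<close>

lemma count_forms_eq:
  "count_forms G i v P c1 c2 X = (\<Sum>f\<in>form_set G i v P c1 c2 X. card {g \<in> G. bc_act g v = f})"
  by (simp add: count_forms_def form_set_def)

lemma count_forms_le:
  assumes "finite (form_set G i v P c1 c2 X)"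
  shows "count_forms G i v P c1 c2 X \<le> card (form_set G i v P c1 c2 X) * card {g. bc_act g v = v}"
proof -
  have "card {g \<in> G. bc_act g v = f} \<le> card {g. bc_act g v = v}" if "f \<in> form_set G i v P c1 c2 X" for f
  proof -
    have "bc_disc f \<noteq> 0" using form_set_int[OF that] by simp
    note fb = fibre_bound[OF this, of v]
    have "card {g \<in> G. bc_act g v = f} \<le> card {g. bc_act g v = f}"
      using fb(1) by (intro card_mono) auto
    then show ?thesis using fb(2) by simp
  qed
  then have "count_forms G i v P c1 c2 X \<le> of_nat (card (form_set G i v P c1 c2 X)) * card {g. bc_act g v = v}"
    unfolding count_forms_eq by (rule sum_bounded_above)
  then show ?thesis by simp
qed

text \<open>Finiteness of the fibres matters here: \<open>card\<close> is \<open>0\<close> on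
  infinite sets, which would drop a form from the count.\<close>

lemma count_forms_ge:
  assumes "finite (form_set G i v P c1 c2 X)"
  shows "card (form_set G i v P c1 c2 X) \<le> count_forms G i v P c1 c2 X"
proof -
  have "1 \<le> card {g \<in> G. bc_act g v = f}" if f: "f \<in> form_set G i v P c1 c2 X" for f
  proof -
    have "bc_disc f \<noteq> 0" using form_set_int[OF f] by simp
    then have "finite {g \<in> G. bc_act g v = f}"
      by (intro finite_subset[OF _ fibre_bound(1)[of f v]]) auto
    moreover have "{g \<in> G. bc_act g v = f} \<noteq> {}" using f by (auto simp: form_set_def)
    ultimately show ?thesis by (simp add: Suc_le_eq card_gt_0_iff)
  qed
  then show ?thesis unfolding count_forms_eq card_eq_sum by (rule sum_mono)
qed

text \<open>The positivity conjunct ensures that the quotients are genuine for large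
  \<open>X\<close>, given that \<open>x / 0 = 0\<close>.\<close>

theorem theorem1:
  fixes \<nu> :: "real \<Rightarrow> real set" and i :: nat and v :: "real bcubic"
    and \<alpha> \<beta> :: int and c_minus c_plus :: real
  assumes "gauss_sections \<nu>"
    and "i \<in> {0, 1}"
    and "v \<in> V_real i" and "shape v = \<i>"
    and "coprime \<alpha> \<beta>" and "(\<alpha>, \<beta>) \<noteq> (1, 0)" and "(\<alpha>, \<beta>) \<noteq> (-1, 0)"
    and "0 < c_minus" and "c_minus < c_plus"
  shows "(\<forall>\<^sub>F X in at_top. N_all \<nu> i v (\<alpha>, \<beta>) c_minus c_plus X > 0) \<and>
    ((\<lambda>T. Limsup at_top (\<lambda>X. ereal (real (N_cusp \<nu> T i v (\<alpha>, \<beta>) c_minus c_plus X)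
                                  / real (N_all \<nu> i v (\<alpha>, \<beta>) c_minus c_plus X))))
      \<longlongrightarrow> 0) at_top"
proof -
  let ?N = "\<lambda>X. real (N_all \<nu> i v (\<alpha>, \<beta>) c_minus c_plus X)"
  let ?M = "\<lambda>T X. real (N_cusp \<nu> T i v (\<alpha>, \<beta>) c_minus c_plus X)"
  let ?F = "\<lambda>G X. form_set G i v (\<alpha>, \<beta>) c_minus c_plus X"
  \<comment> \<open>A primitive vector on the first axis is \<open>(1, 0)\<close> or
    \<open>(-1, 0)\<close>.\<close>
  have \<beta>: "\<beta> \<noteq> 0" using assms(5-7) by auto
  have v: "bc_disc v \<noteq> 0" using assms(3) by (auto simp: V_real_def split: if_splits)
  have c2: "0 < c_plus" using assms(8,9) by simp
  obtain K where K: "K > 0"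
    and box: "\<And>T L. \<lbrakk>T > 0; L > 0\<rbrakk> \<Longrightarrow> coords ` ?F (fund_dom_cusp \<nu> T) (L ^ 4) \<subseteq> cusp_box (K * L) T"
    using coords_in_cusp_box[OF assms(1) v c2] by metis
  obtain C L0 where C: "C > 0" "L0 > 0"
    and lower: "\<And>L. L \<ge> L0 \<Longrightarrow> \<exists>S \<subseteq> ?F (fund_dom \<nu>) (L ^ 4). C * L ^ 3 \<le> real (card S)"
    using form_set_card_ge[OF assms(1,3) v assms(5) \<beta> assms(8,9)] by metis
  have fin: "finite (?F (fund_dom_cusp \<nu> T) (L ^ 4))"
    and card_le: "card (?F (fund_dom_cusp \<nu> T) (L ^ 4)) \<le> card (cusp_box (K * L) T)"
    if "T > 0" "L > 0" for T L
    using inj_on_coords[OF \<beta>] box[OF that] finite_cusp_box[of T "K * L"] that K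
    by (meson mult_pos_pos inj_on_finite card_inj_on_le)+
  have N: "C * L ^ 3 \<le> ?N (L ^ 4)" if L: "L \<ge> L0" for L
  proof -
    have f: "finite (?F (fund_dom \<nu>) (L ^ 4))" unfolding fund_dom_eq_cusp using L C by (intro fin) auto
    obtain S where S: "S \<subseteq> ?F (fund_dom \<nu>) (L ^ 4)" "C * L ^ 3 \<le> real (card S)"
      using lower[OF L] by blast
    have "card S \<le> N_all \<nu> i v (\<alpha>, \<beta>) c_minus c_plus (L ^ 4)"
      unfolding N_all_def using card_mono[OF f S(1)] count_forms_ge[OF f] by simp
    then show ?thesis using S(2) by linarith
  qed
  define m where "m = card {g. bc_act g v = v}"
  have M: "?M T (L ^ 4) \<le> 30 * (K * L) ^ 3 / (T - 2) * m" if T: "T > 2" and L: "L > 0" for T L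
  proof -
    \<comment> \<open>The box count needs an integral height; rounding \<open>T\<close> down turns
      \<open>n - 1\<close> into at least \<open>T - 2\<close>.\<close>
    define n where "n = nat \<lfloor>T\<rfloor>"
    have n: "2 \<le> n" "real n \<le> T" "T - 2 \<le> real n - 1" using T unfolding n_def by linarith+
    have KL: "K * L > 0" using K L by simp
    have "real (card (?F (fund_dom_cusp \<nu> T) (L ^ 4))) \<le> real (card (cusp_box (K * L) T))"
      using card_le[of T L] T L by simp
    also have "\<dots> \<le> real (card (cusp_box (K * L) (real n)))"
      using n KL by (intro of_nat_mono card_mono cusp_box_mono finite_cusp_box) auto
    also have "\<dots> \<le> 30 * (K * L) ^ 3 / (real n - 1)" by (rule card_cusp_box[OF n(1) KL])
    also have "\<dots> \<le> 30 * (K * L) ^ 3 / (T - 2)"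
      using n T KL by (intro divide_left_mono mult_pos_pos) auto
    finally have c: "real (card (?F (fund_dom_cusp \<nu> T) (L ^ 4))) \<le> 30 * (K * L) ^ 3 / (T - 2)" .
    have "?M T (L ^ 4) \<le> real (card (?F (fund_dom_cusp \<nu> T) (L ^ 4)) * m)"
      unfolding N_cusp_def m_def using T L by (intro of_nat_mono count_forms_le fin) auto
    also have "\<dots> = real (card (?F (fund_dom_cusp \<nu> T) (L ^ 4))) * m" by simp
    also have "\<dots> \<le> 30 * (K * L) ^ 3 / (T - 2) * m" by (intro mult_right_mono c) simp
    finally show ?thesis .
  qed
  define B where "B = 30 * K ^ 3 * m / C"
  have ratio: "?M T (L ^ 4) / ?N (L ^ 4) \<le> B / (T - 2)" if T: "T > 2" and L: "L \<ge> L0" for T L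
  proof -
    have L1: "L > 0" using L C by simp
    then have pos: "C * L ^ 3 > 0" using C by simp
    have "?M T (L ^ 4) / ?N (L ^ 4) \<le> (30 * (K * L) ^ 3 / (T - 2) * m) / (C * L ^ 3)"
      using M[OF T L1] N[OF L] pos T K L1 by (intro frac_le) auto
    \<comment> \<open>Both bounds are of order \<open>L ^ 3\<close>, so \<open>L\<close> cancels and
      the bound is uniform in \<open>L\<close>.\<close>
    also have "\<dots> = B / (T - 2)" using C L1 T by (simp add: B_def field_simps)
    finally show ?thesis .
  qed
  have root: "root 4 X ^ 4 = X" "root 4 X \<ge> L0" if "X \<ge> L0 ^ 4" for X
  proof -
    have "X \<ge> 0" using that C by (meson order.trans zero_le_power less_imp_le)
    then show "root 4 X ^ 4 = X" by simp
    have "root 4 (L0 ^ 4) \<le> root 4 X" using that by simp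
    then show "root 4 X \<ge> L0" using C by (simp add: real_root_power_cancel)
  qed
  have ev: "\<forall>\<^sub>F X in at_top. X \<ge> L0 ^ 4" by (rule eventually_ge_at_top)
  have pos: "\<forall>\<^sub>F X in at_top. N_all \<nu> i v (\<alpha>, \<beta>) c_minus c_plus X > 0"
    using ev
  proof eventually_elim
    case (elim X)
    have "0 < root 4 X" using root(2)[OF elim] C by linarith
    then have "0 < C * root 4 X ^ 3" using C by (intro mult_pos_pos zero_less_power)
    then have "0 < ?N X" using N[OF root(2)[OF elim]] unfolding root(1)[OF elim] by linarith
    then show ?case by simp
  qed
  have up: "Limsup at_top (\<lambda>X. ereal (?M T X / ?N X)) \<le> ereal (B / (T - 2))" if "T > 2" for T
  proof (rule Limsup_bounded)
    show "\<forall>\<^sub>F X in at_top. ereal (?M T X / ?N X) \<le> ereal (B / (T - 2))"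
      using ev
    proof eventually_elim
      case (elim X)
      show ?case using ratio[OF that root(2)[OF elim]] unfolding root(1)[OF elim] by simp
    qed
  qed
  have lo: "0 \<le> Limsup at_top (\<lambda>X. ereal (?M T X / ?N X))" for T
    by (rule le_Limsup) auto
  have "filterlim (\<lambda>T :: real. -2 + T) at_top at_top"
    by (rule filterlim_tendsto_add_at_top[OF tendsto_const filterlim_ident])
  then have "((\<lambda>T. B / (-2 + T)) \<longlongrightarrow> 0) at_top"
    by (intro tendsto_divide_0[OF tendsto_const] filterlim_at_top_imp_at_infinity)
  then have "((\<lambda>T. ereal (B / (T - 2))) \<longlongrightarrow> 0) at_top"
    by (simp add: zero_ereal_def)
  then have "((\<lambda>T. Limsup at_top (\<lambda>X. ereal (?M T X / ?N X))) \<longlongrightarrow> 0) at_top"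
  proof (rule tendsto_sandwich[rotated -1])
    show "\<forall>\<^sub>F T in at_top. 0 \<le> Limsup at_top (\<lambda>X. ereal (?M T X / ?N X))" using lo by simp
    show "\<forall>\<^sub>F T in at_top. Limsup at_top (\<lambda>X. ereal (?M T X / ?N X)) \<le> ereal (B / (T - 2))"
      using eventually_gt_at_top[of "2 :: real"] by eventually_elim (rule up)
  qed simp
  then show ?thesis using pos by simp
qed

end
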